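(* Let $\zeta$ be a transcendental real number. Then $\zeta$ is a $U$-number if and only if $\lim_{n\to\infty}\lambda_n(\zeta)>0$. More precisely, if $\zeta$ is a $U_m$-number, then $\lambda_n(\zeta)=\frac{1}{m-1}$ for all sufficiently large $n$. Moreover, $\zeta$ is a $T$-number if and only if \[\lim_{n\to\infty}\lambda_n(\zeta)=0\quad\text{and}\quad \limsup_{n\to\infty} n\lambda_n(\zeta)=\infty.\] Finally, $\zeta$ is an $S$-number if and only if $\limsup_{n\to\infty} n\lambda_n(\zeta)<\infty$.
   Context: For an integer polynomial $P$, $H(P)$ denotes the maximum modulus of its coefficients. For $n\ge 1$, $w_n(\zeta)$ is the supremum of $w$ such that $0<|P(\zeta)|\le H(P)^{-w}$ has infinitely many solutions $P\in\mathbb{Z}[T]$ of degree at most $n$. $\lambda_n(\zeta)$ is the supremum of $\lambda$ such that the system $1\le |x|\le X$, $\max_{1\le i\le n}|\zeta^i x-y_i|\le X^{-\lambda}$ has a solution $(x,y_1,\dots,y_n)\in\mathbb{Z}^{n+1}$ for arbitrarily large $X$; the sequence $(\lambda_n(\zeta))_{n\ge1}$ is non-increasing, so its limit exists in $[0,\infty]$. Mahler's classification: $\zeta$ is a $U_m$-number if $w_m(\zeta)=\infty$ and $m$ is the smallest such index; a $U$-number is a $U_m$-number for some $m\ge1$; $\zeta$ is a $T$-number if $w_n(\zeta)<\infty$ for all $n$ but $\limsup_{n\to\infty}w_n(\zeta)/n=\infty$; $\zeta$ is an $S$-number if $\limsup_{n\to\infty} w_n(\zeta)/n<\infty$. Convention: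 $1/0=\infty$, $1/\infty=0$. *)

theory Defs
  imports Complex_Main "HOL-Library.Extended_Real" "HOL-Computational_Algebra.Polynomial"
begin

definition height :: "int poly \<Rightarrow> int" where
  "height P = Max ((\<lambda>i. \<bar>coeff P i\<bar>) ` {..degree P})"

text \<open>The exponents are meant for \<open>n \<ge> 1\<close>. They are extended reals, since they may be
  infinite. In particular \<open>1 / 0 = \<infinity>\<close> and \<open>1 / \<infinity> = 0\<close> hold for them.\<close>

definition w_exp :: "nat \<Rightarrow> real \<Rightarrow> ereal" where
  "w_exp n \<zeta> = Sup {ereal w | w :: real.
     infinite {P :: int poly. degree P \<le> n \<and>
       0 < \<bar>poly (map_poly real_of_int P) \<zeta>\<bar> \<and>
       \<bar>poly (map_poly real_of_int P) \<zeta>\<bar> \<le> real_of_int (height P) powr (- w)}}"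

definition lambda_exp :: "nat \<Rightarrow> real \<Rightarrow> ereal" where
  "lambda_exp n \<zeta> = Sup {ereal l | l :: real.
     \<forall>X0 :: real. \<exists>X \<ge> X0. \<exists>(x :: int) (y :: nat \<Rightarrow> int).
       1 \<le> \<bar>x\<bar> \<and> real_of_int \<bar>x\<bar> \<le> X \<and>
       Max ((\<lambda>i. \<bar>\<zeta> ^ i * real_of_int x - real_of_int (y i)\<bar>) ` {1..n}) \<le> X powr (- l)}"

definition U_index :: "nat \<Rightarrow> real \<Rightarrow> bool" where
  "U_index m \<zeta> \<longleftrightarrow> 1 \<le> m \<and> w_exp m \<zeta> = \<infinity> \<and> (\<forall>k. 1 \<le> k \<and> k < m \<longrightarrow> w_exp k \<zeta> \<noteq> \<infinity>)"

definition U_number :: "real \<Rightarrow> bool" where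
  "U_number \<zeta> \<longleftrightarrow> (\<exists>m \<ge> 1. U_index m \<zeta>)"

definition T_number :: "real \<Rightarrow> bool" where
  "T_number \<zeta> \<longleftrightarrow> (\<forall>n \<ge> 1. w_exp n \<zeta> < \<infinity>) \<and>
     limsup (\<lambda>n. w_exp n \<zeta> / ereal (real n)) = \<infinity>"

definition S_number :: "real \<Rightarrow> bool" where
  "S_number \<zeta> \<longleftrightarrow> limsup (\<lambda>n. w_exp n \<zeta> / ereal (real n)) < \<infinity>"

end

theory Submission
  imports "Berlekamp_Zassenhaus.Factor_Bound" Defs
begin

text \<open>
  Two transference statements carry the theorem.

  (A) If \<open>\<lambda>\<^sub>m\<^sub>+\<^sub>n > 1/m\<close> with \<open>m \<le> n\<close>, then \<open>w\<^sub>m \<ge> n - 1\<close>. A good approximation \<open>(y\<^sub>0, \<dots>, y\<^sub>m\<^sub>+\<^sub>n)\<close> defines the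
  functional \<open>T\<^sup>i \<mapsto> y\<^sub>i\<close>. Dirichlet's theorem yields polynomials \<open>P\<close> of degree at most \<open>m\<close> and \<open>Q\<close> of
  degree at most \<open>n\<close> whose multiples up to degree \<open>m + n\<close> take integer values of modulus less than 1 under
  this functional, hence are annihilated. By the Euclidean algorithm so is a common divisor \<open>G\<close>.
  Its height is bounded in terms of that of \<open>Q\<close>, which is about \<open>\<bar>y\<^sub>0\<bar>\<close> to the power \<open>1/n\<close>, while
  annihilation forces \<open>\<bar>G(\<zeta>)\<bar>\<close> to be smaller than \<open>1/\<bar>y\<^sub>0\<bar>\<close>.

  (B) If \<open>w\<^sub>m > n + 1 + ms\<close>, then \<open>\<lambda>\<^sub>m\<^sub>+\<^sub>n \<ge> s/(n + 1 + s(m - 1))\<close>. Given \<open>P\<close> of degree at most \<open>m\<close> with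
  \<open>P(\<zeta>)\<close> small, the pigeonhole principle yields an integer vector annihilated by all multiples of \<open>P\<close> up to
  degree \<open>m + n\<close> whose last \<open>m\<close> coordinates are nearly geometric, and the recurrence with coefficients from
  \<open>P\<close> propagates this to all coordinates. Translating \<open>P\<close> by an integer first makes its constant
  coefficient comparable to the height, so that solving the recurrence downwards loses only a constant.
\<close>

section \<open>Polynomials acting on sequences\<close>

definition pairing :: "(nat \<Rightarrow> 'a::comm_ring_1) \<Rightarrow> 'a poly \<Rightarrow> 'a" where
  "pairing y p = (\<Sum>i\<le>degree p. coeff p i * y i)"

lemma pairing_eq_sum: "degree p \<le> n \<Longrightarrow> pairing y p = (\<Sum>i\<le>n. coeff p i * y i)"
  unfolding pairing_def by (rule sum.mono_neutral_left) (auto simp: coeff_eq_0 not_le)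

lemma pairing_powers: "pairing (\<lambda>i. x ^ i) p = poly p x"
  by (simp add: pairing_def poly_altdef)

lemma pairing_0 [simp]: "pairing y 0 = 0"
  by (simp add: pairing_def)

lemma pairing_add: "pairing y (p + q) = pairing y p + pairing y q"
proof -
  define n where "n = max (degree p) (degree q)"
  have "degree p \<le> n" "degree q \<le> n" "degree (p + q) \<le> n"
    using degree_add_le[of p n q] by (auto simp: n_def)
  then show ?thesis by (simp add: pairing_eq_sum[of _ n] sum.distrib distrib_right)
qed

lemma pairing_smult: "pairing y (smult c p) = c * pairing y p"
  using pairing_eq_sum[OF degree_smult_le[of c p], of y]
  by (simp add: pairing_def sum_distrib_left mult_ac)

lemma pairing_diff: "pairing y (p - q) = pairing y p - pairing y q"
  using pairing_add[of y p "- q"] pairing_smult[of y "- 1" q] by simp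

lemma pairing_pCons_0: "pairing y (pCons 0 p) = pairing (\<lambda>i. y (Suc i)) p"
  unfolding pairing_eq_sum[OF degree_pCons_le] sum.atMost_Suc_shift by (simp add: pairing_def)

lemma pairing_scale_left: "pairing (\<lambda>i. c * y i) p = c * pairing y p"
  by (simp add: pairing_def sum_distrib_left mult_ac)

lemma pairing_diff_left: "pairing (\<lambda>i. y i - z i) p = pairing y p - pairing z p"
  by (simp add: pairing_def right_diff_distrib sum_subtractf)

lemma (in comm_ring_hom) pairing_map_poly:
  "pairing (\<lambda>i. hom (y i)) (map_poly hom p) = hom (pairing y p)"
  by (subst pairing_eq_sum[OF degree_map_poly_le]) (simp add: pairing_def hom_distribs)

definition annihilates :: "nat \<Rightarrow> 'a::comm_ring_1 poly \<Rightarrow> (nat \<Rightarrow> 'a) \<Rightarrow> bool" where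
  "annihilates n p y \<longleftrightarrow> (\<forall>j\<le>n. pairing (\<lambda>i. y (i + j)) p = 0)"

lemma annihilatesD: "annihilates n p y \<Longrightarrow> j \<le> n \<Longrightarrow> pairing (\<lambda>i. y (i + j)) p = 0"
  by (simp add: annihilates_def)

lemma annihilates_mono: "annihilates n p y \<Longrightarrow> m \<le> n \<Longrightarrow> annihilates m p y"
  by (simp add: annihilates_def)

lemma annihilates_shift: "annihilates (n + k) p y \<Longrightarrow> annihilates n p (\<lambda>i. y (i + k))"
  by (simp add: annihilates_def add.assoc)

lemma pairing_mult_eq_0: "annihilates (degree a) p y \<Longrightarrow> pairing y (a * p) = 0"
proof (induction a arbitrary: y)
  case 0
  then show ?case by simp
next
  case (pCons c a)
  have "annihilates (degree a) p (\<lambda>i. y (Suc i))" if "a \<noteq> 0"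
    using pCons.prems that annihilates_shift[of "degree a" 1 p y] by simp
  then have "pairing (\<lambda>i. y (Suc i)) (a * p) = 0" using pCons.IH by (cases "a = 0") auto
  moreover have "pairing y p = 0" using annihilatesD[OF pCons.prems, of 0] by simp
  ultimately show ?case by (simp add: pairing_add pairing_smult pairing_pCons_0)
qed

lemma annihilates_mult:
  assumes "annihilates (degree a + n) p y"
  shows "annihilates n (a * p) y"
  unfolding annihilates_def
proof (intro allI impI)
  fix j assume "j \<le> n"
  then have "annihilates (degree a) p (\<lambda>i. y (i + j))"
    using assms by (intro annihilates_shift annihilates_mono[OF assms]) auto
  then show "pairing (\<lambda>i. y (i + j)) (a * p) = 0" by (rule pairing_mult_eq_0)
qed

lemma annihilates_diff: "annihilates n p y \<Longrightarrow> annihilates n q y \<Longrightarrow> annihilates n (p - q) y"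
  by (simp add: annihilates_def pairing_diff)

lemma degree_div_add_le:
  fixes p q :: "'a::field poly"
  assumes "degree q \<le> degree p"
  shows "degree (p div q) + degree q \<le> degree p"
proof (cases "p div q = 0")
  case False
  then have "q \<noteq> 0" by auto
  then have "degree (p mod q) \<le> degree p" using assms degree_mod_less[of q p] by auto
  then have "degree (p div q * q) \<le> degree p"
    unfolding minus_mod_eq_div_mult[symmetric] by (intro degree_diff_le) auto
  then show ?thesis using False \<open>q \<noteq> 0\<close> by (simp add: degree_mult_eq)
qed (use assms in simp)

lemma annihilates_mod:
  fixes p q :: "'a::field_gcd poly"
  assumes "annihilates (degree q) p y" "annihilates (degree p) q y"
  shows "annihilates (degree q) (p mod q) y"
proof (cases "degree p < degree q")
  case True
  then show ?thesis using assms(1) by (simp add: mod_poly_less)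
next
  case False
  then have "degree (p div q) + degree q \<le> degree p" by (intro degree_div_add_le) simp
  then have "annihilates (degree q) (p div q * q) y"
    by (intro annihilates_mult annihilates_mono[OF assms(2)])
  then show ?thesis
    unfolding minus_div_mult_eq_mod[symmetric] by (rule annihilates_diff[OF assms(1)])
qed

text \<open>The hypotheses are invariant under a division step of the Euclidean algorithm.\<close>

lemma pairing_gcd_eq_0:
  fixes p q :: "'a::field_gcd poly"
  assumes "annihilates (degree q) p y" "annihilates (degree p) q y"
  shows "pairing y (gcd p q) = 0"
  using assms
proof (induction p q rule: eucl_induct)
  case (zero p)
  then have "pairing y p = 0" using annihilatesD[of 0 p y 0] by simp
  moreover have "p = smult (unit_factor (lead_coeff p)) (normalize p)"
    using unit_factor_mult_normalize[of p] by (simp add: unit_factor_poly_def)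
  then have "pairing y p = unit_factor (lead_coeff p) * pairing y (normalize p)"
    by (metis pairing_smult)
  ultimately show ?case by (cases "p = 0") auto
next
  case (mod p q)
  have "annihilates (degree q) (p mod q) y" using mod.prems by (rule annihilates_mod)
  moreover have "degree (p mod q) \<le> degree p"
    by (cases "degree p < degree q")
      (use degree_mod_less[OF mod.hyps, of p] in \<open>auto simp: mod_poly_less\<close>)+
  then have "annihilates (degree (p mod q)) q y" by (rule annihilates_mono[OF mod.prems(2)])
  ultimately have "pairing y (gcd q (p mod q)) = 0" by (intro mod.IH)
  then show ?case using mod.hyps by (simp add: gcd_mod_right gcd.commute[of p])
qed

lemma exists_common_divisor_pairing_eq_0:
  fixes P Q :: "int poly"
  assumes "P \<noteq> 0" "annihilates (degree Q) P y" "annihilates (degree P) Q y"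
  obtains G where "G dvd P" "G dvd Q" "pairing y G = 0"
proof -
  let ?r = "of_int_poly :: int poly \<Rightarrow> rat poly"
  have "annihilates n (?r p) (\<lambda>i. rat_of_int (y i))" if "annihilates n p y" for n p
    using that of_int_hom.pairing_map_poly[where 'a = rat and p = p]
    by (simp add: annihilates_def)
  then have "pairing (\<lambda>i. rat_of_int (y i)) (gcd (?r P) (?r Q)) = 0"
    by (intro pairing_gcd_eq_0) (simp_all add: assms(2,3))
  moreover obtain d G where dG: "rat_to_normalized_int_poly (gcd (?r P) (?r Q)) = (d, G)"
    by fastforce
  moreover have "gcd (?r P) (?r Q) = smult d (?r G)" "d > 0"
    by (rule rat_to_normalized_int_poly[OF dG])+
  ultimately have "pairing y G = 0"
    by (simp add: pairing_smult of_int_hom.pairing_map_poly)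
  moreover have "G dvd p" if "gcd (?r P) (?r Q) dvd ?r p" for p
    using that rat_to_int_factor_explicit[OF _ dG] by (metis dvd_def)
  then have "G dvd P" "G dvd Q" by simp_all
  ultimately show ?thesis using that by blast
qed

section \<open>Heights of integer polynomials\<close>

abbreviation ipoly :: "int poly \<Rightarrow> real \<Rightarrow> real" where
  "ipoly P x \<equiv> poly (of_int_poly P) x"

lemma abs_coeff_le_height: "\<bar>coeff P i\<bar> \<le> height P"
proof (cases "i \<le> degree P")
  case True
  then show ?thesis unfolding height_def by (intro Max_ge) auto
next
  case False
  have "\<bar>coeff P (degree P)\<bar> \<le> height P" unfolding height_def by (intro Max_ge) auto
  then show ?thesis using False by (simp add: coeff_eq_0)
qed

lemma height_leI: "(\<And>i. \<bar>coeff P i\<bar> \<le> h) \<Longrightarrow> height P \<le> h"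
  unfolding height_def by (subst Max_le_iff) auto

lemma height_le_iff: "height P \<le> h \<longleftrightarrow> range (coeff P) \<subseteq> {- h..h}"
proof
  assume "height P \<le> h"
  then have "\<bar>coeff P i\<bar> \<le> h" for i using abs_coeff_le_height[of P i] by linarith
  then show "range (coeff P) \<subseteq> {- h..h}" by (auto simp: abs_le_iff minus_le_iff)
next
  assume "range (coeff P) \<subseteq> {- h..h}"
  then have "coeff P i \<in> {- h..h}" for i by blast
  then show "height P \<le> h" by (intro height_leI) (auto simp: abs_le_iff minus_le_iff)
qed

lemma height_nonneg: "0 \<le> height P"
  using abs_coeff_le_height[of P 0] by linarith

lemma height_ge_1: "P \<noteq> 0 \<Longrightarrow> 1 \<le> height P"
  using abs_coeff_le_height[of P "degree P"] leading_coeff_neq_0[of P] by linarith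

lemma bij_betw_coeff_PiE:
  fixes S :: "'a::zero set"
  assumes "0 \<in> S"
  shows "bij_betw (\<lambda>p. restrict (coeff p) {..n})
    {p. degree p \<le> n \<and> range (coeff p) \<subseteq> S} ({..n} \<rightarrow>\<^sub>E S)"
proof (rule bij_betw_byWitness)
  define from_coeffs where "from_coeffs f = Poly (map f [0..<Suc n])" for f :: "nat \<Rightarrow> 'a"
  have coeff_from: "coeff (from_coeffs f) i = (if i \<le> n then f i else 0)" for f i
    by (auto simp: from_coeffs_def nth_default_def simp del: upt_Suc)
  show "\<forall>p\<in>{p. degree p \<le> n \<and> range (coeff p) \<subseteq> S}. from_coeffs (restrict (coeff p) {..n}) = p"
    by (auto simp: poly_eq_iff coeff_from coeff_eq_0)
  show "\<forall>f\<in>{..n} \<rightarrow>\<^sub>E S. restrict (coeff (from_coeffs f)) {..n} = f"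
    by (auto simp: coeff_from fun_eq_iff restrict_def PiE_def extensional_def)
  show "(\<lambda>p. restrict (coeff p) {..n}) ` {p. degree p \<le> n \<and> range (coeff p) \<subseteq> S} \<subseteq> {..n} \<rightarrow>\<^sub>E S"
    by (auto simp: PiE_def)
  show "from_coeffs ` ({..n} \<rightarrow>\<^sub>E S) \<subseteq> {p. degree p \<le> n \<and> range (coeff p) \<subseteq> S}"
    using assms by (auto simp: coeff_from intro!: degree_le)
qed

lemma card_polys_with_coeffs_in:
  assumes "0 \<in> S"
  shows "card {p. degree p \<le> n \<and> range (coeff p) \<subseteq> S} = card S ^ Suc n"
  using bij_betw_same_card[OF bij_betw_coeff_PiE[OF assms]] by (simp add: card_PiE)

lemma finite_polys_height_le: "finite {P. degree P \<le> n \<and> height P \<le> h}"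
proof (cases "0 \<le> h")
  case True
  then show ?thesis
    using bij_betw_finite[OF bij_betw_coeff_PiE[of "{- h..h}" n]]
    by (simp add: height_le_iff finite_PiE)
next
  case False
  then have "\<not> height P \<le> h" for P using height_nonneg[of P] by linarith
  then show ?thesis by simp
qed

lemma abs_pairing_of_int_poly_le:
  fixes y :: "nat \<Rightarrow> real"
  assumes "degree P \<le> n" "\<And>i. i \<le> n \<Longrightarrow> \<bar>y i\<bar> \<le> W"
  shows "\<bar>pairing y (of_int_poly P)\<bar> \<le> real (n + 1) * height P * W"
proof -
  have "\<bar>pairing y (of_int_poly P)\<bar> \<le> (\<Sum>i\<le>n. \<bar>real_of_int (coeff P i) * y i\<bar>)"
    using assms(1) by (simp add: pairing_eq_sum[of _ n] sum_abs)
  also have "\<dots> \<le> (\<Sum>i\<le>n. height P * W)"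
    unfolding abs_mult using assms(2) abs_coeff_le_height[of P] height_nonneg[of P]
    by (intro sum_mono mult_mono) (auto simp flip: of_int_abs)
  finally show ?thesis by (simp add: algebra_simps)
qed

lemma mahler_measure_le_height:
  assumes "degree P \<le> n"
  shows "mahler_measure P \<le> real (n + 1) * height P"
proof -
  have "(\<Sum>a\<leftarrow>coeffs P. a * a) \<le> (\<Sum>a\<leftarrow>coeffs P. (height P)\<^sup>2)"
  proof (rule sum_list_mono)
    fix a assume "a \<in> set (coeffs P)"
    then obtain i where "a = coeff P i" by (auto simp: coeffs_def split: if_splits)
    then show "a * a \<le> (height P)\<^sup>2"
      using abs_coeff_le_height[of P i] abs_le_square_iff[of a "height P"]
      by (simp add: power2_eq_square)
  qed
  also have "\<dots> \<le> int (n + 1) * (height P)\<^sup>2"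
    using assms by (auto simp: sum_list_triv coeffs_def intro!: mult_right_mono)
  also have "\<dots> \<le> (int (n + 1))\<^sup>2 * (height P)\<^sup>2"
    by (intro mult_right_mono self_le_power) auto
  also have "\<dots> = (int (n + 1) * height P)\<^sup>2" by (simp add: power_mult_distrib)
  finally have "real_of_int (\<Sum>a\<leftarrow>coeffs P. a * a) \<le> real_of_int ((int (n + 1) * height P)\<^sup>2)"
    by (simp only: of_int_le_iff)
  then have "sqrt (\<Sum>a\<leftarrow>coeffs P. a * a) \<le> real (n + 1) * height P"
    using height_nonneg[of P] by (intro real_le_lsqrt) auto
  then show ?thesis using Landau_inequality_mahler_measure[of P] by linarith
qed

lemma height_dvd_le:
  assumes "P \<noteq> 0" "degree P \<le> n" "G dvd P"
  shows "height G \<le> 2 ^ n * real (n + 1) * height P"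
proof -
  have dG: "degree G \<le> n" using dvd_imp_degree_le[OF assms(3,1)] assms(2) by simp
  have "real_of_int \<bar>coeff G k\<bar> \<le> 2 ^ n * (real (n + 1) * height P)" for k
  proof -
    have "real_of_int \<bar>coeff G k\<bar> \<le> real (degree G choose k) * mahler_measure G"
      by (rule Mignotte_bound)
    also have "\<dots> \<le> 2 ^ n * (real (n + 1) * height P)"
    proof (intro mult_mono mahler_measure_ge_0)
      have "degree G choose k \<le> 2 ^ degree G" by (rule binomial_le_pow2)
      also have "\<dots> \<le> 2 ^ n" using dG by (intro power_increasing) auto
      finally have "real (degree G choose k) \<le> real (2 ^ n)" by (rule of_nat_mono)
      then show "real (degree G choose k) \<le> 2 ^ n" by simp
      show "mahler_measure G \<le> real (n + 1) * height P"
        using mahler_measure_dvd[OF assms(1,3)] mahler_measure_le_height[OF assms(2)] by linarith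
    qed auto
    finally show ?thesis .
  qed
  then have "height G \<le> \<lfloor>2 ^ n * (real (n + 1) * height P)\<rfloor>"
    by (intro height_leI) (simp add: le_floor_iff)
  then show ?thesis by (simp add: le_floor_iff mult.assoc)
qed

lemma abs_coeff_translate_le:
  fixes p :: "'a::linordered_idom poly"
  assumes "\<And>i. \<bar>coeff p i\<bar> \<le> h"
  shows "\<bar>coeff (p \<circ>\<^sub>p [:b, 1:]) k\<bar> \<le> (2 + \<bar>b\<bar>) ^ degree p * h"
  using assms
proof (induction p arbitrary: k)
  case 0
  then show ?case by simp
next
  case (pCons a p)
  have a: "\<bar>a\<bar> \<le> h" and p: "\<bar>coeff p i\<bar> \<le> h" for i
    using pCons.prems[of 0] pCons.prems[of "Suc i"] by auto
  then have h: "0 \<le> h" using abs_ge_zero order_trans by blast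
  define c where "c = (2 + \<bar>b\<bar>) ^ degree p * h"
  have q: "\<bar>coeff (p \<circ>\<^sub>p [:b, 1:]) i\<bar> \<le> c" for i unfolding c_def by (rule pCons.IH[OF p])
  have hc: "1 * h \<le> c" unfolding c_def using h by (intro mult_right_mono one_le_power) auto
  show ?case
  proof (cases "p = 0")
    case True
    then show ?thesis using a h by (cases k) auto
  next
    case False
    let ?q = "p \<circ>\<^sub>p [:b, 1:]"
    have "coeff (pCons a p \<circ>\<^sub>p [:b, 1:]) k = coeff [:a:] k + b * coeff ?q k + coeff (pCons 0 ?q) k"
      by (simp add: pcompose_pCons)
    moreover have "\<bar>coeff [:a:] k\<bar> \<le> c" using a h hc by (cases k) auto
    moreover have "\<bar>coeff (pCons 0 ?q) k\<bar> \<le> c" using q h hc by (cases k) auto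
    moreover have "\<bar>b * coeff ?q k\<bar> \<le> \<bar>b\<bar> * c"
      unfolding abs_mult using q by (intro mult_left_mono) auto
    ultimately have "\<bar>coeff (pCons a p \<circ>\<^sub>p [:b, 1:]) k\<bar> \<le> c + \<bar>b\<bar> * c + c" by linarith
    also have "\<dots> = (2 + \<bar>b\<bar>) ^ degree (pCons a p) * h"
      using False by (simp add: c_def algebra_simps)
    finally show ?thesis .
  qed
qed

lemma height_translate_le: "height (P \<circ>\<^sub>p [:b, 1:]) \<le> (2 + \<bar>b\<bar>) ^ degree P * height P"
  by (intro height_leI abs_coeff_translate_le abs_coeff_le_height)

lemma exists_lagrange_basis_poly:
  fixes a :: "'a::field"
  assumes "finite A" "a \<in> A"
  shows "\<exists>p. degree p < card A \<and> poly p a = 1 \<and> (\<forall>b\<in>A - {a}. poly p b = 0)"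
proof (intro exI conjI)
  let ?p = "\<Prod>b\<in>A - {a}. [:- b, 1:]" and ?c = "\<Prod>b\<in>A - {a}. a - b"
  have c: "?c \<noteq> 0" using assms(1) by auto
  have "degree ?p \<le> card (A - {a})"
    using degree_prod_sum_le[of "A - {a}" "\<lambda>b. [:- b, 1:]"] assms(1) by (simp add: o_def)
  also have "\<dots> < card A" using assms by (intro psubset_card_mono) auto
  finally show "degree (smult (1 / ?c) ?p) < card A" using c by simp
  show "poly (smult (1 / ?c) ?p) a = 1" using c by (simp add: poly_prod)
  show "\<forall>b\<in>A - {a}. poly (smult (1 / ?c) ?p) b = 0" using assms(1) by (auto simp: poly_prod)
qed

lemma exists_coeff_bound_of_values:
  fixes A :: "real set"
  assumes "finite A"
  shows "\<exists>C. \<forall>p M k. degree p < card A \<longrightarrow> (\<forall>a\<in>A. \<bar>poly p a\<bar> \<le> M) \<longrightarrow> \<bar>coeff p k\<bar> \<le> C * M"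
proof -
  obtain l where l: "\<And>a. a \<in> A \<Longrightarrow> degree (l a) < card A" "\<And>a. a \<in> A \<Longrightarrow> poly (l a) a = 1"
    "\<And>a b. a \<in> A \<Longrightarrow> b \<in> A \<Longrightarrow> b \<noteq> a \<Longrightarrow> poly (l a) b = 0"
    using exists_lagrange_basis_poly[OF assms] by (metis Diff_iff singletonD)
  define C where "C = (\<Sum>a\<in>A. \<Sum>k<card A. \<bar>coeff (l a) k\<bar>)"
  have "\<bar>coeff p k\<bar> \<le> C * M" if p: "degree p < card A" "\<forall>a\<in>A. \<bar>poly p a\<bar> \<le> M" for p M k
  proof -
    have "p = (\<Sum>a\<in>A. smult (poly p a) (l a))"
    proof (rule poly_eqI_degree[where A = A])
      show "degree (\<Sum>a\<in>A. smult (poly p a) (l a)) < card A"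
        using l(1) p(1) by (intro degree_sum_less) (auto intro: le_less_trans[OF degree_smult_le])
      show "poly p b = poly (\<Sum>a\<in>A. smult (poly p a) (l a)) b" if "b \<in> A" for b
      proof -
        have "poly (\<Sum>a\<in>A. smult (poly p a) (l a)) b = (\<Sum>a\<in>A. if b = a then poly p b else 0)"
          unfolding poly_sum by (intro sum.cong) (use l(2,3) that in auto)
        then show ?thesis using assms that by simp
      qed
    qed (rule p(1))
    from arg_cong[OF this, of "\<lambda>p. coeff p k"]
    have "coeff p k = (\<Sum>a\<in>A. poly p a * coeff (l a) k)" by (simp add: coeff_sum)
    also have "\<bar>\<dots>\<bar> \<le> (\<Sum>a\<in>A. M * (\<Sum>k<card A. \<bar>coeff (l a) k\<bar>))"
    proof (rule order_trans[OF sum_abs sum_mono])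
      fix a assume a: "a \<in> A"
      then have "\<bar>coeff (l a) k\<bar> \<le> (\<Sum>k<card A. \<bar>coeff (l a) k\<bar>)"
        using l(1)[OF a]
        by (cases "k < card A") (auto intro: member_le_sum sum_nonneg simp: coeff_eq_0)
      then show "\<bar>poly p a * coeff (l a) k\<bar> \<le> M * (\<Sum>k<card A. \<bar>coeff (l a) k\<bar>)"
        unfolding abs_mult using p(2) a by (intro mult_mono) auto
    qed
    finally show ?thesis by (simp add: C_def sum_distrib_left mult.commute)
  qed
  then show ?thesis by blast
qed

lemma exists_value_comparable_to_height:
  "\<exists>C. \<forall>P. degree P \<le> m \<longrightarrow> (\<exists>b\<in>{0..int m}. height P \<le> C * real_of_int \<bar>poly P b\<bar>)"
proof -
  let ?A = "real_of_int ` {0..int m}"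
  have card: "card ?A = Suc m" by (simp add: card_image inj_on_def)
  obtain C where C: "\<And>p M k. degree p \<le> m \<Longrightarrow> (\<forall>a\<in>?A. \<bar>poly p a\<bar> \<le> M) \<Longrightarrow> \<bar>coeff p k\<bar> \<le> C * M"
    using exists_coeff_bound_of_values[of ?A] unfolding card less_Suc_eq_le
    by (metis finite_imageI finite_atLeastAtMost_int)
  have "\<exists>b\<in>{0..int m}. height P \<le> C * real_of_int \<bar>poly P b\<bar>" if P: "degree P \<le> m" for P
  proof -
    obtain b where b: "b \<in> {0..int m}" "\<bar>poly P b\<bar> = Max ((\<lambda>b. \<bar>poly P b\<bar>) ` {0..int m})"
      by (rule obtains_MAX[of "{0..int m}" "\<lambda>b. \<bar>poly P b\<bar>"]) auto
    then have "\<bar>poly P t\<bar> \<le> \<bar>poly P b\<bar>" if "t \<in> {0..int m}" for t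
      using that by simp
    then have "\<forall>t\<in>?A. \<bar>ipoly P t\<bar> \<le> real_of_int \<bar>poly P b\<bar>"
      by (auto simp del: of_int_abs simp flip: of_int_abs)
    then have "real_of_int \<bar>coeff P k\<bar> \<le> C * real_of_int \<bar>poly P b\<bar>" for k
      using C[of "of_int_poly P" _ k] P by simp
    then have "height P \<le> \<lfloor>C * real_of_int \<bar>poly P b\<bar>\<rfloor>"
      by (intro height_leI) (simp add: le_floor_iff)
    then show ?thesis using b(1) by (auto simp: le_floor_iff)
  qed
  then show ?thesis by blast
qed

section \<open>Approximations and exponents\<close>

lemma eventually_mult_powr_less:
  fixes a c d :: real
  assumes "a < 0" "0 < d"
  shows "\<forall>\<^sub>F X in at_top. c * X powr a < d"
proof -
  have "((\<lambda>X :: real. c * X powr a) \<longlongrightarrow> c * 0) at_top"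
    by (intro tendsto_mult tendsto_const tendsto_neg_powr assms filterlim_ident)
  then show ?thesis using assms(2) by (intro order_tendstoD) auto
qed

lemma eventually_mult_powr_le_powr:
  fixes D l s \<kappa> :: real
  assumes "0 < D" "0 < \<kappa>" "l < s / \<kappa>"
  shows "\<forall>\<^sub>F h in at_top. D * h powr (- s) \<le> (D * h powr \<kappa>) powr (- l)"
proof -
  have "l * \<kappa> - s < 0" using assms(2,3) by (simp add: field_simps)
  then have "\<forall>\<^sub>F h in at_top. D * D powr l * h powr (l * \<kappa> - s) < 1"
    by (rule eventually_mult_powr_less) simp
  then show ?thesis using eventually_gt_at_top[of 0]
  proof eventually_elim
    case (elim h)
    have "D * h powr (- s) * (D * h powr \<kappa>) powr l = D * D powr l * h powr (l * \<kappa> - s)"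
      using assms(1) elim(2)
      by (simp add: powr_mult powr_powr mult.commute powr_diff powr_minus field_simps)
    then have "D * h powr (- s) * (D * h powr \<kappa>) powr l \<le> 1" using elim(1) by linarith
    moreover have "0 < (D * h powr \<kappa>) powr l" using assms(1) elim(2) by simp
    ultimately show ?case by (simp add: powr_minus field_simps)
  qed
qed

lemma abs_power_le_max_power:
  fixes x :: real
  assumes "i \<le> n"
  shows "\<bar>x ^ i\<bar> \<le> max 1 \<bar>x\<bar> ^ n"
proof -
  have "\<bar>x\<bar> ^ i \<le> max 1 \<bar>x\<bar> ^ i" by (intro power_mono) auto
  also have "\<dots> \<le> max 1 \<bar>x\<bar> ^ n" using assms by (intro power_increasing) auto
  finally show ?thesis by (simp add: power_abs)
qed

definition approximates_powers :: "real \<Rightarrow> nat \<Rightarrow> (nat \<Rightarrow> int) \<Rightarrow> real \<Rightarrow> bool" where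
  "approximates_powers \<zeta> n y \<epsilon> \<longleftrightarrow> (\<forall>i\<le>n. \<bar>\<zeta> ^ i * y 0 - y i\<bar> \<le> \<epsilon>)"

lemma approximates_powersD: "approximates_powers \<zeta> n y \<epsilon> \<Longrightarrow> i \<le> n \<Longrightarrow> \<bar>\<zeta> ^ i * y 0 - y i\<bar> \<le> \<epsilon>"
  by (simp add: approximates_powers_def)

lemma approximates_powers_mono:
  "approximates_powers \<zeta> n y \<epsilon> \<Longrightarrow> m \<le> n \<Longrightarrow> \<epsilon> \<le> \<delta> \<Longrightarrow> approximates_powers \<zeta> m y \<delta>"
  unfolding approximates_powers_def by (meson order_trans)

lemma approximates_powers_nonneg: "approximates_powers \<zeta> n y \<epsilon> \<Longrightarrow> 0 \<le> \<epsilon>"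
  using approximates_powersD[of \<zeta> n y \<epsilon> 0] by simp

lemma abs_pairing_approximation_le:
  assumes "approximates_powers \<zeta> (k + j) y \<epsilon>" "degree P \<le> k"
  shows "\<bar>\<zeta> ^ j * y 0 * ipoly P \<zeta> - pairing (\<lambda>i. y (i + j)) P\<bar> \<le> real (k + 1) * height P * \<epsilon>"
proof -
  have "\<zeta> ^ j * y 0 * ipoly P \<zeta> - pairing (\<lambda>i. y (i + j)) P
      = pairing (\<lambda>i. \<zeta> ^ (i + j) * y 0 - y (i + j)) (of_int_poly P)"
    using pairing_scale_left[of "\<zeta> ^ j * y 0" "\<lambda>i. \<zeta> ^ i" "of_int_poly P"]
    by (simp add: pairing_diff_left pairing_powers of_int_hom.pairing_map_poly power_add mult_ac)
  also have "\<bar>\<dots>\<bar> \<le> real (k + 1) * height P * \<epsilon>"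
    using assms
    by (intro abs_pairing_of_int_poly_le) (auto intro!: approximates_powersD[OF assms(1)])
  finally show ?thesis .
qed

lemma approximates_powers_translate:
  assumes "approximates_powers \<zeta> n y \<epsilon>"
  shows "approximates_powers (\<zeta> + real_of_int b) n (\<lambda>i. pairing y ([:b, 1:] ^ i))
    ((\<Sum>i\<le>n. real (i + 1) * height ([:b, 1:] ^ i)) * \<epsilon>)"
  unfolding approximates_powers_def
proof (intro allI impI)
  fix i assume i: "i \<le> n"
  have "approximates_powers \<zeta> (i + 0) y \<epsilon>"
    using assms i by (auto intro: approximates_powers_mono)
  moreover have "ipoly ([:b, 1:] ^ i) \<zeta> = (\<zeta> + real_of_int b) ^ i"
    by (simp add: hom_distribs add.commute)
  moreover have "pairing y ([:b, 1:] ^ 0) = y 0" by (simp add: pairing_def)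
  moreover have "degree ([:b, 1:] ^ i) \<le> i" by (simp only: degree_linear_power)
  ultimately have "\<bar>(\<zeta> + real_of_int b) ^ i * pairing y ([:b, 1:] ^ 0) - pairing y ([:b, 1:] ^ i)\<bar>
      \<le> real (i + 1) * height ([:b, 1:] ^ i) * \<epsilon>"
    using abs_pairing_approximation_le[of \<zeta> i 0 y \<epsilon> "[:b, 1:] ^ i"] by (simp add: mult.commute)
  also have "\<dots> \<le> (\<Sum>i\<le>n. real (i + 1) * height ([:b, 1:] ^ i)) * \<epsilon>"
    using i approximates_powers_nonneg[OF assms]
    by (intro mult_right_mono member_le_sum) (auto simp: height_nonneg)
  finally show "\<bar>(\<zeta> + real_of_int b) ^ i * pairing y ([:b, 1:] ^ 0) - pairing y ([:b, 1:] ^ i)\<bar>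
      \<le> (\<Sum>i\<le>n. real (i + 1) * height ([:b, 1:] ^ i)) * \<epsilon>" .
qed

definition power_approximable :: "nat \<Rightarrow> real \<Rightarrow> real \<Rightarrow> bool" where
  "power_approximable n \<zeta> l \<longleftrightarrow> (\<forall>X0. \<exists>X\<ge>X0. \<exists>y. y 0 \<noteq> 0 \<and> real_of_int \<bar>y 0\<bar> \<le> X \<and>
     approximates_powers \<zeta> n y (X powr (- l)))"

lemma lambda_exp_eq_Sup:
  assumes "1 \<le> n"
  shows "lambda_exp n \<zeta> = Sup {ereal l | l. power_approximable n \<zeta> l}"
proof -
  have "(\<exists>(x :: int) y. 1 \<le> \<bar>x\<bar> \<and> real_of_int \<bar>x\<bar> \<le> X \<and>
      Max ((\<lambda>i. \<bar>\<zeta> ^ i * real_of_int x - real_of_int (y i)\<bar>) ` {1..n}) \<le> \<epsilon>)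
    \<longleftrightarrow> (\<exists>y. y 0 \<noteq> 0 \<and> real_of_int \<bar>y 0\<bar> \<le> X \<and> approximates_powers \<zeta> n y \<epsilon>)"
    (is "?L \<longleftrightarrow> ?R") if "0 \<le> \<epsilon>" for X \<epsilon>
  proof
    assume ?L
    then obtain x :: int and y where x: "1 \<le> \<bar>x\<bar>" "real_of_int \<bar>x\<bar> \<le> X"
      and "Max ((\<lambda>i. \<bar>\<zeta> ^ i * real_of_int x - real_of_int (y i)\<bar>) ` {1..n}) \<le> \<epsilon>" by blast
    then have y: "\<bar>\<zeta> ^ i * real_of_int x - real_of_int (y i)\<bar> \<le> \<epsilon>" if "i \<in> {1..n}" for i
      using that assms by (subst (asm) Max_le_iff) auto
    have "approximates_powers \<zeta> n (y(0 := x)) \<epsilon>"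
      using y \<open>0 \<le> \<epsilon>\<close> by (auto simp: approximates_powers_def Suc_le_eq)
    then show ?R using x by (intro exI[of _ "y(0 := x)"]) auto
  next
    assume ?R
    then obtain y where y: "y 0 \<noteq> 0" "real_of_int \<bar>y 0\<bar> \<le> X" "approximates_powers \<zeta> n y \<epsilon>" by blast
    have "Max ((\<lambda>i. \<bar>\<zeta> ^ i * real_of_int (y 0) - real_of_int (y i)\<bar>) ` {1..n}) \<le> \<epsilon>"
      using assms y(3) by (subst Max_le_iff) (auto simp: approximates_powers_def)
    moreover have "1 \<le> \<bar>y 0\<bar>" using y(1) by linarith
    ultimately show ?L using y(2) by blast
  qed
  then show ?thesis unfolding lambda_exp_def power_approximable_def by simp
qed

lemma lambda_exp_antimono:
  assumes "1 \<le> m" "m \<le> n"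
  shows "lambda_exp n \<zeta> \<le> lambda_exp m \<zeta>"
proof -
  have "power_approximable m \<zeta> l" if "power_approximable n \<zeta> l" for l
    using that assms(2) unfolding power_approximable_def
    by (meson approximates_powers_mono order_refl)
  then show ?thesis using assms by (auto simp: lambda_exp_eq_Sup intro!: Sup_subset_mono)
qed

lemma lambda_exp_nonneg:
  assumes "1 \<le> n"
  shows "0 \<le> lambda_exp n \<zeta>"
proof -
  have "\<bar>\<zeta> ^ i - real_of_int \<lfloor>\<zeta> ^ i\<rfloor>\<bar> \<le> 1" for i by linarith
  then have approx: "approximates_powers \<zeta> n (\<lambda>i. \<lfloor>\<zeta> ^ i\<rfloor>) (max 1 X0 powr (- 0))" for X0
    by (simp add: approximates_powers_def)
  have "power_approximable n \<zeta> 0"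
    unfolding power_approximable_def
  proof
    fix X0
    show "\<exists>X\<ge>X0. \<exists>y. y 0 \<noteq> 0 \<and> real_of_int \<bar>y 0\<bar> \<le> X \<and>
        approximates_powers \<zeta> n y (X powr (- 0))"
      by (intro exI[of _ "max 1 X0"] exI[of _ "\<lambda>i. \<lfloor>\<zeta> ^ i\<rfloor>"] conjI approx) simp_all
  qed
  then show ?thesis using assms by (auto simp: lambda_exp_eq_Sup zero_ereal_def intro!: Sup_upper)
qed

lemma lambda_exp_tendsto_lim: "(\<lambda>n. lambda_exp n \<zeta>) \<longlonglongrightarrow> lim (\<lambda>n. lambda_exp n \<zeta>)"
proof -
  have "decseq (\<lambda>n. lambda_exp (Suc n) \<zeta>)"
    by (intro decseq_SucI lambda_exp_antimono) auto
  then have "(\<lambda>n. lambda_exp (Suc n) \<zeta>) \<longlonglongrightarrow> (INF n. lambda_exp (Suc n) \<zeta>)" by (rule LIMSEQ_INF)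
  then have "(\<lambda>n. lambda_exp n \<zeta>) \<longlonglongrightarrow> (INF n. lambda_exp (Suc n) \<zeta>)" by (rule LIMSEQ_imp_Suc)
  then show ?thesis by (simp add: limI)
qed

lemma lambda_exp_lim_nonneg: "0 \<le> lim (\<lambda>n. lambda_exp n \<zeta>)"
  by (rule LIMSEQ_le_const[OF lambda_exp_tendsto_lim]) (use lambda_exp_nonneg in blast)

lemma le_lambda_expI:
  fixes C \<kappa> s :: real
  assumes "1 \<le> n" "0 < \<kappa>" and ap: "\<And>h0. \<exists>h\<ge>h0. \<exists>y. y 0 \<noteq> 0 \<and> real_of_int \<bar>y 0\<bar> \<le> C * h powr \<kappa> \<and>
    approximates_powers \<zeta> n y (C * h powr (- s))"
  shows "ereal (s / \<kappa>) \<le> lambda_exp n \<zeta>"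
proof -
  have "ereal l \<le> lambda_exp n \<zeta>" if l: "l < s / \<kappa>" for l
  proof -
    define D where "D = max 1 C"
    have D: "1 \<le> D" "C \<le> D" by (simp_all add: D_def)
    have "power_approximable n \<zeta> l" unfolding power_approximable_def
    proof
      fix X0 :: real
      have "\<forall>\<^sub>F h in at_top. X0 * h powr (- \<kappa>) < 1"
        using assms(2) by (intro eventually_mult_powr_less) auto
      moreover have "\<forall>\<^sub>F h in at_top. D * h powr (- s) \<le> (D * h powr \<kappa>) powr (- l)"
        using D(1) assms(2) l by (intro eventually_mult_powr_le_powr) auto
      ultimately have "\<forall>\<^sub>F h in at_top. X0 \<le> h powr \<kappa> \<and>
          D * h powr (- s) \<le> (D * h powr \<kappa>) powr (- l)"
        using eventually_gt_at_top[of 0] by eventually_elim (simp add: powr_minus field_simps)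
      then obtain h y where h: "X0 \<le> h powr \<kappa>" "D * h powr (- s) \<le> (D * h powr \<kappa>) powr (- l)"
        and y: "y 0 \<noteq> 0" "real_of_int \<bar>y 0\<bar> \<le> C * h powr \<kappa>"
            "approximates_powers \<zeta> n y (C * h powr (- s))"
        using ap unfolding eventually_at_top_linorder by metis
      define X where "X = D * h powr \<kappa>"
      have "C * h powr (- s) \<le> X powr (- l)"
        using mult_right_mono[OF D(2), of "h powr (- s)"] h(2) by (simp add: X_def)
      then have "approximates_powers \<zeta> n y (X powr (- l))"
        using y(3) by (rule approximates_powers_mono[rotated 2]) simp
      moreover have "real_of_int \<bar>y 0\<bar> \<le> X" "X0 \<le> X"
        using y(2) h(1) mult_right_mono[OF D(2), of "h powr \<kappa>"]
          mult_right_mono[OF D(1), of "h powr \<kappa>"]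
        by (simp_all add: X_def)
      ultimately show "\<exists>X\<ge>X0. \<exists>y. y 0 \<noteq> 0 \<and> real_of_int \<bar>y 0\<bar> \<le> X \<and>
          approximates_powers \<zeta> n y (X powr (- l))"
        using y(1) by blast
    qed
    then show ?thesis unfolding lambda_exp_eq_Sup[OF assms(1)] by (intro Sup_upper) blast
  qed
  then show ?thesis by (meson ereal_dense2 ereal_less_eq(3) less_ereal.simps(1) not_le)
qed

lemma lambda_exp_translate_le:
  assumes "1 \<le> n"
  shows "lambda_exp n \<zeta> \<le> lambda_exp n (\<zeta> + real_of_int b)"
  unfolding lambda_exp_eq_Sup[OF assms, of \<zeta>]
proof (rule Sup_least)
  fix e assume "e \<in> {ereal l |l. power_approximable n \<zeta> l}"
  then obtain l where l: "e = ereal l" "power_approximable n \<zeta> l" by blast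
  define C where "C = max 1 (\<Sum>i\<le>n. real (i + 1) * height ([:b, 1:] ^ i))"
  have "ereal (l / 1) \<le> lambda_exp n (\<zeta> + real_of_int b)"
  proof (rule le_lambda_expI[OF assms, where C = C])
    fix h0
    obtain X y where X: "max 1 h0 \<le> X"
      and y: "y 0 \<noteq> 0" "real_of_int \<bar>y 0\<bar> \<le> X" "approximates_powers \<zeta> n y (X powr (- l))"
      using l(2) unfolding power_approximable_def by blast
    let ?z = "\<lambda>i. pairing y ([:b, 1:] ^ i)"
    have "approximates_powers (\<zeta> + real_of_int b) n ?z (C * X powr (- l))"
      using approximates_powers_translate[OF y(3), of b]
      by (rule approximates_powers_mono) (auto simp: C_def intro!: mult_right_mono)
    moreover have "?z 0 = y 0" by (simp add: pairing_def)
    moreover have "X \<le> C * X powr 1" using X mult_right_mono[of 1 C X] by (simp add: C_def)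
    then have "real_of_int \<bar>y 0\<bar> \<le> C * X powr 1" using y(2) by linarith
    ultimately show "\<exists>h\<ge>h0. \<exists>z. z 0 \<noteq> 0 \<and> real_of_int \<bar>z 0\<bar> \<le> C * h powr 1 \<and>
        approximates_powers (\<zeta> + real_of_int b) n z (C * h powr (- l))"
      using X y(1) by (intro exI[of _ X] exI[of _ ?z] conjI) simp_all
  qed simp
  then show "e \<le> lambda_exp n (\<zeta> + real_of_int b)" using l(1) by simp
qed

lemma lambda_exp_translate:
  assumes "1 \<le> n"
  shows "lambda_exp n (\<zeta> + real_of_int b) = lambda_exp n \<zeta>"
  using lambda_exp_translate_le[OF assms, of \<zeta> b]
    lambda_exp_translate_le[OF assms, of "\<zeta> + real_of_int b" "- b"]
  by simp

lemma irrational_multiples_away_from_int: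
  fixes \<zeta> :: real and K :: int
  assumes "\<zeta> \<notin> \<rat>"
  shows "\<exists>\<delta>>0. \<forall>x y :: int. x \<noteq> 0 \<longrightarrow> \<bar>x\<bar> \<le> K \<longrightarrow> \<delta> \<le> \<bar>\<zeta> * x - y\<bar>"
proof -
  let ?dist = "\<lambda>x :: int. \<bar>\<zeta> * x - round (\<zeta> * x)\<bar>"
  define A where "A = insert 1 (?dist ` ({- K..K} - {0}))"
  have fin: "finite A" "A \<noteq> {}" by (auto simp: A_def)
  have "\<zeta> * x \<noteq> y" if "x \<noteq> 0" for x y :: int
  proof
    assume "\<zeta> * x = y"
    then have "\<zeta> = y / x" using that by (simp add: field_simps)
    then show False using assms by auto
  qed
  then have "0 < Min A" using fin by (auto simp: A_def)
  moreover have "Min A \<le> \<bar>\<zeta> * x - y\<bar>" if "x \<noteq> 0" "\<bar>x\<bar> \<le> K" for x y :: int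
  proof -
    have "?dist x \<in> A" unfolding A_def using that by (intro insertI2 imageI) auto
    then have "Min A \<le> ?dist x" by (rule Min_le[OF fin(1)])
    also have "\<dots> \<le> \<bar>\<zeta> * x - y\<bar>" by (rule round_diff_minimal)
    finally show ?thesis .
  qed
  ultimately show ?thesis by blast
qed

definition approximations :: "real \<Rightarrow> nat \<Rightarrow> real \<Rightarrow> (nat \<Rightarrow> int) filter" where
  "approximations \<zeta> n l = inf (filtercomap (\<lambda>y. real_of_int \<bar>y 0\<bar>) at_top)
     (principal {y. approximates_powers \<zeta> n y (real_of_int \<bar>y 0\<bar> powr (- l))})"

lemma eventually_approximations_compose:
  assumes "\<forall>\<^sub>F X in at_top. \<Phi> X"
  shows "\<forall>\<^sub>F y in approximations \<zeta> n l. \<Phi> (real_of_int \<bar>y 0\<bar>)"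
  unfolding approximations_def
  by (intro filter_leD[OF inf_le1] eventually_filtercomapI assms)

lemma eventually_approximates_powers:
  "\<forall>\<^sub>F y in approximations \<zeta> n l. approximates_powers \<zeta> n y (real_of_int \<bar>y 0\<bar> powr (- l))"
  unfolding approximations_def by (rule filter_leD[OF inf_le2]) (simp add: eventually_principal)

lemma less_lambda_expE:
  assumes "\<zeta> \<notin> \<rat>" "1 \<le> n" "0 \<le> a" "ereal a < lambda_exp n \<zeta>"
  obtains l where "a < l" "approximations \<zeta> n l \<noteq> bot"
proof -
  obtain l where l: "a < l" "power_approximable n \<zeta> l"
    using assms(4) unfolding lambda_exp_eq_Sup[OF assms(2)] less_Sup_iff by auto
  have "\<exists>y. K \<le> real_of_int \<bar>y 0\<bar> \<and>
      approximates_powers \<zeta> n y (real_of_int \<bar>y 0\<bar> powr (- l))" for K :: real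
  proof -
    obtain \<delta> where \<delta>: "\<delta> > 0" "\<And>x y :: int. x \<noteq> 0 \<Longrightarrow> \<bar>x\<bar> \<le> \<lceil>K\<rceil> \<Longrightarrow> \<delta> \<le> \<bar>\<zeta> * x - y\<bar>"
      using irrational_multiples_away_from_int[OF assms(1)] by blast
    have "\<forall>\<^sub>F X in at_top. 1 * X powr (- l) < \<delta>"
      by (rule eventually_mult_powr_less) (use l(1) assms(3) \<delta>(1) in auto)
    then obtain X y where "X powr (- l) < \<delta>"
      and y: "y 0 \<noteq> 0" "real_of_int \<bar>y 0\<bar> \<le> X" "approximates_powers \<zeta> n y (X powr (- l))"
      using l(2) unfolding power_approximable_def eventually_at_top_linorder by (metis mult_1)
    then have "\<not> \<bar>y 0\<bar> \<le> \<lceil>K\<rceil>"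
      using \<delta>(2)[OF y(1), of "y 1"] approximates_powersD[OF y(3) assms(2)] by auto
    then have "K \<le> real_of_int \<bar>y 0\<bar>" by linarith
    moreover have "X powr (- l) \<le> real_of_int \<bar>y 0\<bar> powr (- l)"
      using y(1,2) l(1) assms(3) by (intro powr_mono2') auto
    then have "approximates_powers \<zeta> n y (real_of_int \<bar>y 0\<bar> powr (- l))"
      using y(3) by (rule approximates_powers_mono[rotated 2]) simp
    ultimately show ?thesis by blast
  qed
  then have "approximations \<zeta> n l \<noteq> bot"
    by (auto simp: approximations_def trivial_limit_def eventually_inf_principal
        eventually_filtercomap_at_top_linorder)
  then show ?thesis using l(1) that by blast
qed

lemma ipoly_neq_0:
  assumes "\<not> algebraic x" "P \<noteq> 0"
  shows "ipoly P x \<noteq> 0"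
  using assms algebraicI[of "of_int_poly P" x] by auto

lemma less_w_expD:
  assumes "ereal w < w_exp n \<zeta>"
  shows "infinite {P. degree P \<le> n \<and> 0 < \<bar>ipoly P \<zeta>\<bar> \<and> \<bar>ipoly P \<zeta>\<bar> \<le> height P powr (- w)}"
proof -
  obtain v where v: "w < v"
    and "infinite {P. degree P \<le> n \<and> 0 < \<bar>ipoly P \<zeta>\<bar> \<and> \<bar>ipoly P \<zeta>\<bar> \<le> height P powr (- v)}"
    using assms unfolding w_exp_def less_Sup_iff by auto
  moreover have "height P powr (- v) \<le> height P powr (- w)" if "0 < \<bar>ipoly P \<zeta>\<bar>" for P
  proof -
    have "1 \<le> height P" using that by (intro height_ge_1) auto
    then show ?thesis using v by (intro powr_mono) auto
  qed
  then have "{P. degree P \<le> n \<and> 0 < \<bar>ipoly P \<zeta>\<bar> \<and> \<bar>ipoly P \<zeta>\<bar> \<le> height P powr (- v)}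
      \<subseteq> {P. degree P \<le> n \<and> 0 < \<bar>ipoly P \<zeta>\<bar> \<and> \<bar>ipoly P \<zeta>\<bar> \<le> height P powr (- w)}"
    by (force intro: order_trans)
  ultimately show ?thesis using infinite_super by blast
qed

lemma le_w_expI:
  assumes "\<not> algebraic \<zeta>" "0 \<le> w"
    and small: "\<And>\<delta>. 0 < \<delta> \<Longrightarrow> \<exists>P. P \<noteq> 0 \<and> degree P \<le> n \<and> \<bar>ipoly P \<zeta>\<bar> * height P powr w < \<delta>"
  shows "ereal w \<le> w_exp n \<zeta>"
proof -
  let ?S = "{P. degree P \<le> n \<and> 0 < \<bar>ipoly P \<zeta>\<bar> \<and> \<bar>ipoly P \<zeta>\<bar> \<le> height P powr (- w)}"
  have "infinite ?S"
  proof
    let ?V = "insert 1 ((\<lambda>P. \<bar>ipoly P \<zeta>\<bar>) ` ?S)"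
    assume "finite ?S"
    then have fin: "finite ?V" by simp
    then have "0 < Min ?V" by (subst Min_gr_iff) auto
    then obtain P where P: "P \<noteq> 0" "degree P \<le> n" "\<bar>ipoly P \<zeta>\<bar> * height P powr w < Min ?V"
      using small by blast
    have h: "1 \<le> real_of_int (height P)" using height_ge_1[OF P(1)] by simp
    then have "1 \<le> height P powr w" using assms(2) by (rule ge_one_powr_ge_zero)
    then have "\<bar>ipoly P \<zeta>\<bar> * 1 \<le> \<bar>ipoly P \<zeta>\<bar> * height P powr w" by (intro mult_left_mono) auto
    then have less_Min: "\<bar>ipoly P \<zeta>\<bar> < Min ?V" using P(3) by linarith
    have "Min ?V \<le> 1" by (intro Min_le fin) simp
    then have "\<bar>ipoly P \<zeta>\<bar> \<le> height P powr (- w)"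
      using P(3) h by (simp add: powr_minus_divide pos_le_divide_eq)
    then have "\<bar>ipoly P \<zeta>\<bar> \<in> ?V" using P(1,2) ipoly_neq_0[OF assms(1)] by auto
    then have "Min ?V \<le> \<bar>ipoly P \<zeta>\<bar>" by (rule Min_le[OF fin])
    then show False using less_Min by simp
  qed
  then show ?thesis unfolding w_exp_def by (intro Sup_upper) blast
qed

section \<open>Good simultaneous approximations produce small polynomial values\<close>

lemma real_pigeonhole:
  fixes f :: "'a \<Rightarrow> real"
  assumes "N + 1 < card A" "0 < N" "0 < B" "\<And>x. x \<in> A \<Longrightarrow> \<bar>f x\<bar> \<le> B"
  obtains x y where "x \<in> A" "y \<in> A" "x \<noteq> y" "\<bar>f x - f y\<bar> \<le> 2 * B / real N"
proof -
  define box where "box x = \<lfloor>(f x + B) * (N / (2 * B))\<rfloor>" for x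
  have "box x \<in> {0..int N}" if "x \<in> A" for x
  proof -
    have "0 \<le> f x + B" "f x + B \<le> 2 * B" using assms(4)[OF that] by auto
    then have "0 \<le> (f x + B) * (N / (2 * B))" "(f x + B) * (N / (2 * B)) \<le> 2 * B * (N / (2 * B))"
      using assms(3) by (auto intro: mult_right_mono simp del: times_divide_eq_right)
    moreover have "2 * B * (N / (2 * B)) = N" using assms(3) by simp
    ultimately show ?thesis by (auto simp: box_def floor_le_iff le_floor_iff)
  qed
  then have "card (box ` A) \<le> card {0..int N}" by (intro card_mono) auto
  then have "\<not> inj_on box A" using assms(1) by (intro pigeonhole) auto
  then obtain x y where xy: "x \<in> A" "y \<in> A" "x \<noteq> y" "box x = box y" by (auto simp: inj_on_def)
  have "\<bar>(f x + B) * (N / (2 * B)) - (f y + B) * (N / (2 * B))\<bar> < 1"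
    using xy(4) unfolding box_def by linarith
  also have "(f x + B) * (N / (2 * B)) - (f y + B) * (N / (2 * B)) = (f x - f y) * (N / (2 * B))"
    by (simp only: left_diff_distrib distrib_right)
  finally have "\<bar>f x - f y\<bar> * (N / (2 * B)) < 1" using assms(3) by (simp add: abs_mult)
  then have "\<bar>f x - f y\<bar> \<le> 2 * B / N" using assms(2,3) by (simp add: field_simps)
  then show ?thesis using that xy by blast
qed

lemma dirichlet_pairing:
  fixes \<alpha> :: "nat \<Rightarrow> real" and h :: nat
  assumes "1 \<le> n" "1 \<le> h" "0 < W" and W: "\<And>i. i \<le> n \<Longrightarrow> \<bar>\<alpha> i\<bar> \<le> W"
  obtains P where "P \<noteq> 0" "degree P \<le> n" "height P \<le> int h"
    "\<bar>pairing \<alpha> (of_int_poly P)\<bar> \<le> 2 * real (n + 1) * W / real h ^ n"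
proof -
  define A where "A = {P :: int poly. degree P \<le> n \<and> range (coeff P) \<subseteq> {0..int h}}"
  have A: "degree P \<le> n" "coeff P i \<in> {0..int h}" if "P \<in> A" for P i
    using that unfolding A_def by blast+
  have "h ^ n + 1 \<le> (h + 1) ^ n" using power_strict_mono[of h "h + 1" n] assms(1) by simp
  then have "(h + 1) * (h ^ n + 1) \<le> (h + 1) * (h + 1) ^ n" by (rule mult_le_mono2)
  then have "h ^ Suc n + 1 < card A"
    using assms(2) by (simp add: A_def card_polys_with_coeffs_in nat_add_distrib)
  moreover have "\<bar>pairing \<alpha> (of_int_poly P)\<bar> \<le> real (n + 1) * h * W" if "P \<in> A" for P
  proof -
    have "height P \<le> int h" using A(2)[OF that] by (intro height_leI) auto
    then have "real (n + 1) * height P * W \<le> real (n + 1) * h * W"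
      using assms(3) by (intro mult_right_mono mult_left_mono) auto
    then show ?thesis using abs_pairing_of_int_poly_le[OF A(1)[OF that], of \<alpha> W, OF W] by linarith
  qed
  ultimately obtain P Q where PQ: "P \<in> A" "Q \<in> A" "P \<noteq> Q"
    and "\<bar>pairing \<alpha> (of_int_poly P) - pairing \<alpha> (of_int_poly Q)\<bar>
        \<le> 2 * (real (n + 1) * h * W) / real (h ^ Suc n)"
    using assms(2,3) by (elim real_pigeonhole[rotated 3]) auto
  moreover have "2 * (real (n + 1) * h * W) / real (h ^ Suc n) = 2 * real (n + 1) * W / real h ^ n"
    using assms(2) by simp
  ultimately have "\<bar>pairing \<alpha> (of_int_poly (P - Q))\<bar> \<le> 2 * real (n + 1) * W / real h ^ n"
    by (simp only: of_int_poly_hom.hom_minus pairing_diff)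
  moreover have "\<bar>coeff (P - Q) i\<bar> \<le> int h" for i
    using A(2)[OF PQ(1), of i] A(2)[OF PQ(2), of i] by auto
  then have "height (P - Q) \<le> int h" by (rule height_leI)
  ultimately show ?thesis
    using that[of "P - Q"] PQ A(1) by (auto intro: degree_diff_le)
qed

lemma exists_annihilating_poly:
  fixes h :: nat
  assumes "1 \<le> k" "1 \<le> h" and y: "approximates_powers \<zeta> (k + n) y \<epsilon>"
    and Z: "Z = max 1 \<bar>\<zeta>\<bar> ^ (k + n)"
    and small: "2 * real (k + 1) * Z\<^sup>2 * real_of_int \<bar>y 0\<bar> / real h ^ k + real (k + 1) * h * \<epsilon> < 1"
  obtains P where "P \<noteq> 0" "degree P \<le> k" "height P \<le> int h" "annihilates n P y"
proof -
  have pow_le: "\<bar>\<zeta> ^ i\<bar> \<le> Z" if "i \<le> k + n" for i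
    unfolding Z using that by (rule abs_power_le_max_power)
  have "0 < Z" unfolding Z by (intro zero_less_power) auto
  then obtain P where P: "P \<noteq> 0" "degree P \<le> k" "height P \<le> int h"
    and "\<bar>pairing (\<lambda>i. \<zeta> ^ i) (of_int_poly P)\<bar> \<le> 2 * real (k + 1) * Z / real h ^ k"
    using pow_le by (elim dirichlet_pairing[OF assms(1,2), rotated 2]) auto
  then have value_le: "\<bar>ipoly P \<zeta>\<bar> \<le> 2 * real (k + 1) * Z / real h ^ k"
    by (simp add: pairing_powers)
  have "pairing (\<lambda>i. y (i + j)) P = 0" if "j \<le> n" for j
  proof -
    have "\<bar>\<zeta> ^ j * y 0 * ipoly P \<zeta>\<bar> \<le> Z * \<bar>y 0\<bar> * (2 * real (k + 1) * Z / real h ^ k)"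
      unfolding abs_mult using pow_le[of j] value_le that \<open>0 < Z\<close> by (intro mult_mono) auto
    also have "\<dots> = 2 * real (k + 1) * Z\<^sup>2 * real_of_int \<bar>y 0\<bar> / real h ^ k"
      by (simp add: power2_eq_square)
    finally have "\<bar>\<zeta> ^ j * y 0 * ipoly P \<zeta>\<bar>
        \<le> 2 * real (k + 1) * Z\<^sup>2 * real_of_int \<bar>y 0\<bar> / real h ^ k" .
    moreover have "\<bar>\<zeta> ^ j * y 0 * ipoly P \<zeta> - pairing (\<lambda>i. y (i + j)) P\<bar>
        \<le> real (k + 1) * height P * \<epsilon>"
      using y that P(2)
      by (intro abs_pairing_approximation_le) (auto intro: approximates_powers_mono)
    moreover have "real (k + 1) * height P * \<epsilon> \<le> real (k + 1) * h * \<epsilon>"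
      using P(3) approximates_powers_nonneg[OF y] by (intro mult_right_mono mult_left_mono) auto
    ultimately have "\<bar>real_of_int (pairing (\<lambda>i. y (i + j)) P)\<bar> < 1" using small by linarith
    then show ?thesis by linarith
  qed
  then show ?thesis using that P by (simp add: annihilates_def)
qed

lemma exists_annihilating_poly_height_power_le:
  fixes \<zeta> :: real and k n :: nat
  defines "c \<equiv> 4 * real (k + 1) * (max 1 \<bar>\<zeta>\<bar> ^ (k + n))\<^sup>2"
  assumes "1 \<le> k" "y 0 \<noteq> 0" and y: "approximates_powers \<zeta> (k + n) y \<epsilon>"
    and small: "real (k + 1) * (2 * (c * real_of_int \<bar>y 0\<bar>) powr (1 / k)) * \<epsilon> < 1 / 2"
  obtains P where "P \<noteq> 0" "degree P \<le> k"
    "real_of_int (height P) ^ k \<le> (2 ^ k * c) * real_of_int \<bar>y 0\<bar>" "annihilates n P y"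
proof -
  define Z where "Z = max 1 \<bar>\<zeta>\<bar> ^ (k + n)"
  define X where "X = real_of_int \<bar>y 0\<bar>"
  have X: "1 \<le> X" unfolding X_def using assms(3) by linarith
  have Z: "1 \<le> Z\<^sup>2" unfolding Z_def by (intro one_le_power) auto
  then have c: "1 \<le> c"
    using mult_mono[of 1 "4 * real (k + 1)" 1 "Z\<^sup>2"] by (simp add: c_def Z_def)
  then have cX: "1 \<le> c * X" using X mult_mono[of 1 c 1 X] by simp
  define t where "t = (c * X) powr (1 / k)"
  have t: "1 \<le> t" unfolding t_def using cX by (intro ge_one_powr_ge_zero) auto
  have t_pow: "t ^ k = c * X"
    unfolding t_def using cX assms(2) by (subst powr_realpow[symmetric]) (auto simp: powr_powr)
  define h where "h = nat \<lceil>t\<rceil>"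
  have h: "t \<le> h" "h \<le> 2 * t" "1 \<le> h" unfolding h_def using t by linarith+
  have "2 * real (k + 1) * Z\<^sup>2 * X / real h ^ k \<le> 2 * real (k + 1) * Z\<^sup>2 * X / t ^ k"
    using h(1) t X by (intro divide_left_mono power_mono mult_pos_pos) auto
  also have "\<dots> = 1 / 2" using t_pow Z X by (auto simp: c_def Z_def)
  finally have "2 * real (k + 1) * Z\<^sup>2 * X / real h ^ k \<le> 1 / 2" .
  moreover have "real (k + 1) * h * \<epsilon> \<le> real (k + 1) * (2 * t) * \<epsilon>"
    using h(2) approximates_powers_nonneg[OF y] by (intro mult_right_mono mult_left_mono) auto
  ultimately have "2 * real (k + 1) * Z\<^sup>2 * X / real h ^ k + real (k + 1) * h * \<epsilon> < 1"
    using small unfolding t_def X_def by linarith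
  then obtain P where P: "P \<noteq> 0" "degree P \<le> k" "height P \<le> int h" "annihilates n P y"
    using exists_annihilating_poly[OF assms(2) h(3) y Z_def] unfolding X_def by blast
  have "real_of_int (height P) ^ k \<le> (2 * t) ^ k"
    using h(2) P(3) height_nonneg[of P] by (intro power_mono) linarith+
  also have "\<dots> = (2 ^ k * c) * X" using t_pow by (simp add: power_mult_distrib)
  finally show ?thesis using P that unfolding X_def by blast
qed

lemma eventually_exists_annihilating_poly:
  fixes l :: real
  assumes "1 \<le> k" "1 < l * real k"
  obtains C where "\<forall>\<^sub>F y in approximations \<zeta> (k + n) l. \<exists>P. P \<noteq> 0 \<and> degree P \<le> k \<and>
    real_of_int (height P) ^ k \<le> C * real_of_int \<bar>y 0\<bar> \<and> annihilates n P y"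
proof -
  define c where "c = 4 * real (k + 1) * (max 1 \<bar>\<zeta>\<bar> ^ (k + n))\<^sup>2"
  have "0 < c" by (simp add: c_def)
  have "1 / real k - l < 0" using assms by (simp add: field_simps)
  then have "\<forall>\<^sub>F X in at_top. real (k + 1) * 2 * c powr (1 / k) * X powr (1 / k - l) < 1 / 2"
    by (rule eventually_mult_powr_less) simp
  from eventually_approximations_compose[OF eventually_gt_at_top[of 0]]
    eventually_approximates_powers eventually_approximations_compose[OF this]
  have "\<forall>\<^sub>F y in approximations \<zeta> (k + n) l. \<exists>P. P \<noteq> 0 \<and> degree P \<le> k \<and>
      real_of_int (height P) ^ k \<le> (2 ^ k * c) * real_of_int \<bar>y 0\<bar> \<and> annihilates n P y"
  proof eventually_elim
    case (elim y)
    have "real (k + 1) * (2 * (c * real_of_int \<bar>y 0\<bar>) powr (1 / k)) *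
        real_of_int \<bar>y 0\<bar> powr (- l)
        = real (k + 1) * 2 * c powr (1 / k) * real_of_int \<bar>y 0\<bar> powr (1 / k - l)"
      using \<open>0 < c\<close> elim(1) by (simp add: powr_mult powr_diff powr_minus field_simps)
    also have "\<dots> < 1 / 2" by (rule elim(3))
    finally show ?case
      using exists_annihilating_poly_height_power_le[OF assms(1) _ elim(2)] elim(1)
      unfolding c_def by auto
  qed
  then show ?thesis by (rule that)
qed

lemma eventually_exists_annihilating_factor:
  fixes l :: real
  assumes "1 \<le> m" "m \<le> n" "1 < l * real m"
  obtains C where "\<forall>\<^sub>F y in approximations \<zeta> (m + n) l. \<exists>G. G \<noteq> 0 \<and> degree G \<le> m \<and>
    real_of_int (height G) ^ n \<le> C * real_of_int \<bar>y 0\<bar> \<and> pairing y G = 0"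
proof -
  have "0 < l" using zero_less_mult_pos2[of l "real m"] assms(1,3) by simp
  then have "l * real m \<le> l * real n" using assms(2) by simp
  then have ln: "1 < l * real n" using assms(3) by simp
  obtain C1 where ev1: "\<forall>\<^sub>F y in approximations \<zeta> (m + n) l. \<exists>P. P \<noteq> 0 \<and> degree P \<le> m \<and>
      real_of_int (height P) ^ m \<le> C1 * real_of_int \<bar>y 0\<bar> \<and> annihilates n P y"
    by (rule eventually_exists_annihilating_poly[OF assms(1,3)])
  obtain C2 where ev2: "\<forall>\<^sub>F y in approximations \<zeta> (n + m) l. \<exists>Q. Q \<noteq> 0 \<and> degree Q \<le> n \<and>
      real_of_int (height Q) ^ n \<le> C2 * real_of_int \<bar>y 0\<bar> \<and> annihilates m Q y"
    by (rule eventually_exists_annihilating_poly[OF order_trans[OF assms(1,2)] ln])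
  define E where "E = 2 ^ n * real (n + 1)"
  have "\<forall>\<^sub>F y in approximations \<zeta> (m + n) l. \<exists>G. G \<noteq> 0 \<and> degree G \<le> m \<and>
      real_of_int (height G) ^ n \<le> E ^ n * C2 * real_of_int \<bar>y 0\<bar> \<and> pairing y G = 0"
    using ev1 ev2[unfolded add.commute[of n m]]
  proof eventually_elim
    case (elim y)
    then obtain P Q where P: "P \<noteq> 0" "degree P \<le> m" "annihilates n P y"
      and Q: "Q \<noteq> 0" "degree Q \<le> n" "real_of_int (height Q) ^ n \<le> C2 * real_of_int \<bar>y 0\<bar>"
          "annihilates m Q y"
      by blast
    obtain G where G: "G dvd P" "G dvd Q" "pairing y G = 0"
      by (rule exists_common_divisor_pairing_eq_0[OF P(1) annihilates_mono[OF P(3) Q(2)]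
            annihilates_mono[OF Q(4) P(2)]])
    have "real_of_int (height G) ^ n \<le> (E * height Q) ^ n"
      using height_dvd_le[OF Q(1,2) G(2)] height_nonneg[of G]
      by (intro power_mono) (auto simp: E_def)
    also have "\<dots> \<le> E ^ n * (C2 * real_of_int \<bar>y 0\<bar>)"
      unfolding power_mult_distrib using Q(3) by (intro mult_left_mono) (auto simp: E_def)
    finally have "real_of_int (height G) ^ n \<le> E ^ n * C2 * real_of_int \<bar>y 0\<bar>"
      by (simp only: mult.assoc)
    moreover have "G \<noteq> 0" "degree G \<le> m" using G(1) P(1,2) dvd_imp_degree_le[OF G(1) P(1)] by auto
    ultimately show ?case using G(3) by blast
  qed
  then show ?thesis by (rule that)
qed

lemma small_value_of_annihilating_factor:
  assumes y: "y 0 \<noteq> 0" "approximates_powers \<zeta> (m + n) y (real_of_int \<bar>y 0\<bar> powr (- l))"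
    and G: "degree G \<le> m" "pairing y G = 0" "real_of_int (height G) ^ n \<le> C * real_of_int \<bar>y 0\<bar>"
    and "1 \<le> n"
  shows "\<bar>ipoly G \<zeta>\<bar> * real_of_int (height G) ^ (n - 1)
      \<le> real (m + 1) * C * real_of_int \<bar>y 0\<bar> powr (- l)"
proof -
  define X where "X = real_of_int \<bar>y 0\<bar>"
  define h where "h = real_of_int (height G)"
  have "0 \<le> h" by (simp add: h_def height_nonneg)
  have "\<bar>y 0 * ipoly G \<zeta>\<bar> \<le> real (m + 1) * h * X powr (- l)"
    using abs_pairing_approximation_le[of \<zeta> m 0 y "X powr (- l)" G] G(1,2)
      approximates_powers_mono[OF y(2), of m] by (simp add: h_def X_def)
  then have "X * \<bar>ipoly G \<zeta>\<bar> * h ^ (n - 1) \<le> real (m + 1) * h * X powr (- l) * h ^ (n - 1)"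
    using \<open>0 \<le> h\<close> by (intro mult_right_mono) (auto simp: abs_mult X_def)
  also have "\<dots> = real (m + 1) * X powr (- l) * h ^ n"
    using \<open>1 \<le> n\<close> by (simp add: power_eq_if)
  also have "\<dots> \<le> real (m + 1) * X powr (- l) * (C * X)"
    using G(3) by (intro mult_left_mono) (auto simp: h_def X_def)
  finally have "X * (\<bar>ipoly G \<zeta>\<bar> * h ^ (n - 1)) \<le> X * (real (m + 1) * C * X powr (- l))"
    by (simp add: mult_ac)
  moreover have "0 < X" using y(1) by (simp add: X_def)
  ultimately show ?thesis unfolding h_def X_def by (metis mult_le_cancel_left_pos)
qed

lemma le_w_exp_of_less_lambda_exp:
  assumes "\<not> algebraic \<zeta>" "1 \<le> m" "m \<le> n" "ereal (1 / real m) < lambda_exp (m + n) \<zeta>"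
  shows "ereal (real n - 1) \<le> w_exp m \<zeta>"
proof -
  have irrational: "\<zeta> \<notin> \<rat>" using assms(1) rat_imp_algebraic by blast
  obtain l where l: "1 / real m < l" "approximations \<zeta> (m + n) l \<noteq> bot"
    using assms(2,4) by (elim less_lambda_expE[OF irrational, rotated 2]) auto
  have lm: "1 < l * real m" "0 < l"
    using l(1) assms(2) less_trans[of 0 "1 / real m" l] by (auto simp: field_simps)
  obtain C where ev: "\<forall>\<^sub>F y in approximations \<zeta> (m + n) l. \<exists>G. G \<noteq> 0 \<and> degree G \<le> m \<and>
      real_of_int (height G) ^ n \<le> C * real_of_int \<bar>y 0\<bar> \<and> pairing y G = 0"
    by (rule eventually_exists_annihilating_factor[OF assms(2,3) lm(1)])
  show ?thesis
  proof (rule le_w_expI[OF assms(1)])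
    show "0 \<le> real n - 1" using assms(2,3) by simp
    fix \<delta> :: real assume "0 < \<delta>"
    then have "\<forall>\<^sub>F X in at_top. real (m + 1) * C * X powr (- l) < \<delta>"
      using lm(2) by (intro eventually_mult_powr_less) auto
    from eventually_approximations_compose[OF this] ev eventually_approximates_powers
      eventually_approximations_compose[OF eventually_gt_at_top[of 0]]
    have "\<forall>\<^sub>F y in approximations \<zeta> (m + n) l. \<exists>G. G \<noteq> 0 \<and> degree G \<le> m \<and>
        \<bar>ipoly G \<zeta>\<bar> * real_of_int (height G) ^ (n - 1) < \<delta>"
    proof eventually_elim
      case (elim y)
      then obtain G where G: "G \<noteq> 0" "degree G \<le> m" "pairing y G = 0"
        "real_of_int (height G) ^ n \<le> C * real_of_int \<bar>y 0\<bar>"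
        by blast
      then have "\<bar>ipoly G \<zeta>\<bar> * real_of_int (height G) ^ (n - 1)
          \<le> real (m + 1) * C * real_of_int \<bar>y 0\<bar> powr (- l)"
        using elim(3,4) assms(2,3) by (intro small_value_of_annihilating_factor) auto
      also have "\<dots> < \<delta>" by (rule elim(1))
      finally show ?case using G(1,2) by blast
    qed
    then obtain G where G: "G \<noteq> 0" "degree G \<le> m"
      "\<bar>ipoly G \<zeta>\<bar> * real_of_int (height G) ^ (n - 1) < \<delta>"
      using eventually_happens'[OF l(2)] by blast
    have "height G powr (real n - 1) = real_of_int (height G) ^ (n - 1)"
      using height_ge_1[OF G(1)] assms(2,3) by (simp add: of_nat_diff flip: powr_realpow)
    then show "\<exists>P. P \<noteq> 0 \<and> degree P \<le> m \<and> \<bar>ipoly P \<zeta>\<bar> * height P powr (real n - 1) < \<delta>"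
      using G by metis
  qed
qed

section \<open>Small polynomial values produce good simultaneous approximations\<close>

lemma pairing_eq_head_tail:
  assumes "degree p \<le> m"
  shows "pairing y p = coeff p 0 * y 0 + (\<Sum>i=1..m. coeff p i * y i)"
proof -
  have "{..m} = insert 0 {1..m}" by auto
  then show ?thesis using assms by (simp add: pairing_eq_sum)
qed

lemma exists_small_nonneg_residue:
  fixes c a :: int
  assumes "c \<noteq> 0"
  shows "\<exists>v. c * v + a \<in> {0..<\<bar>c\<bar>}"
proof -
  have "c * (- sgn c * (a div \<bar>c\<bar>)) + a = - (\<bar>c\<bar> * (a div \<bar>c\<bar>)) + a" by (simp add: abs_sgn)
  also have "\<dots> = a mod \<bar>c\<bar>" by (simp add: minus_mult_div_eq_mod[symmetric])
  also have "\<dots> \<in> {0..<\<bar>c\<bar>}" using assms by simp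
  finally show ?thesis by blast
qed

lemma exists_downward_extension:
  fixes R :: "int poly" and a :: "nat \<Rightarrow> int"
  assumes "coeff R 0 \<noteq> 0"
  shows "\<exists>z. (\<forall>i>n. z i = a i) \<and> (\<forall>j\<le>n. pairing (\<lambda>i. z (i + j)) R \<in> {0..<\<bar>coeff R 0\<bar>})"
proof -
  have step: "\<exists>v. pairing (\<lambda>i. (a(j := v)) (i + j)) R \<in> {0..<\<bar>coeff R 0\<bar>}"
    for a :: "nat \<Rightarrow> int" and j
    unfolding pairing_eq_head_tail[OF order_refl]
    using exists_small_nonneg_residue[OF assms] by simp
  show ?thesis
  proof (induction n arbitrary: a)
    case 0
    obtain v where "pairing (\<lambda>i. (a(0 := v)) (i + 0)) R \<in> {0..<\<bar>coeff R 0\<bar>}" using step by blast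
    then show ?case by (intro exI[of _ "a(0 := v)"]) simp
  next
    case (Suc n)
    obtain v where v: "pairing (\<lambda>i. (a(Suc n := v)) (i + Suc n)) R \<in> {0..<\<bar>coeff R 0\<bar>}"
      using step by blast
    obtain z where z: "\<And>i. i > n \<Longrightarrow> z i = (a(Suc n := v)) i"
      "\<And>j. j \<le> n \<Longrightarrow> pairing (\<lambda>i. z (i + j)) R \<in> {0..<\<bar>coeff R 0\<bar>}"
      using Suc[of "a(Suc n := v)"] by blast
    have "pairing (\<lambda>i. z (i + j)) R \<in> {0..<\<bar>coeff R 0\<bar>}" if "j \<le> Suc n" for j
    proof (cases "j = Suc n")
      case True
      then have "(\<lambda>i. z (i + j)) = (\<lambda>i. (a(Suc n := v)) (i + Suc n))" using z(1) by auto
      then show ?thesis using v by simp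
    next
      case False
      then show ?thesis using z(2) that by simp
    qed
    moreover have "z i = a i" if "i > Suc n" for i using z(1)[of i] that by simp
    ultimately show ?case by blast
  qed
qed

lemma abs_floor_diff_le:
  fixes a b :: real
  assumes "0 < D" "\<lfloor>D * frac a\<rfloor> = \<lfloor>D * frac b\<rfloor>"
  shows "\<bar>real_of_int (\<lfloor>a\<rfloor> - \<lfloor>b\<rfloor>) - (a - b)\<bar> \<le> 1 / D"
proof -
  have "\<bar>D * frac a - D * frac b\<bar> < 1" using assms(2) by linarith
  then have "D * \<bar>frac a - frac b\<bar> < 1"
    using assms(1) by (simp add: abs_mult flip: right_diff_distrib)
  then have "\<bar>frac a - frac b\<bar> \<le> 1 / D" using assms(1) by (simp add: field_simps)
  moreover have "real_of_int (\<lfloor>a\<rfloor> - \<lfloor>b\<rfloor>) - (a - b) = - (frac a - frac b)" by (simp add: frac_def)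
  ultimately show ?thesis by (simp only: abs_minus_cancel)
qed

lemma pigeonhole_atMost_card:
  assumes "finite T" "\<And>q. f q \<in> T"
  obtains q q' where "q \<le> card T" "q' \<le> card T" "q \<noteq> q'" "f q = f q'"
proof -
  have "card (f ` {..card T}) \<le> card T" using assms by (intro card_mono) auto
  then have "\<not> inj_on f {..card T}" by (intro pigeonhole) simp
  then show ?thesis using that by (auto simp: inj_on_def)
qed

text \<open>In place of Minkowski's theorem on linear forms: complete each number \<open>q\<close> downwards to a
  sequence with last entry \<open>q\<close> that \<open>R\<close> annihilates up to remainders. Two values of \<open>q\<close> not exceeding
  the number of patterns of remainders and discretised fractional parts share their pattern, and
  \<open>R\<close> annihilates the difference of the two sequences.\<close>

lemma exists_annihilated_approximation:
  fixes R :: "int poly" and \<theta> :: "nat \<Rightarrow> real" and D :: nat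
  assumes R0: "coeff R 0 \<noteq> 0" and "1 \<le> m" "1 \<le> D"
  obtains z where "z (n + m) \<noteq> 0" "\<bar>z (n + m)\<bar> \<le> \<bar>coeff R 0\<bar> ^ (n + 1) * int D ^ (m - 1)"
    "annihilates n R z" "\<And>i. n < i \<Longrightarrow> i < n + m \<Longrightarrow> \<bar>z i - \<theta> i * z (n + m)\<bar> \<le> 1 / real D"
proof -
  have "\<forall>q :: nat. \<exists>z. (\<forall>i>n. z i = (if i = n + m then int q else \<lfloor>\<theta> i * real q\<rfloor>)) \<and>
      (\<forall>j\<le>n. pairing (\<lambda>i. z (i + j)) R \<in> {0..<\<bar>coeff R 0\<bar>})"
    by (intro allI exists_downward_extension[OF R0])
  then obtain z :: "nat \<Rightarrow> nat \<Rightarrow> int" where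
    top: "\<And>q i. i > n \<Longrightarrow> z q i = (if i = n + m then int q else \<lfloor>\<theta> i * real q\<rfloor>)" and
    residue: "\<And>q j. j \<le> n \<Longrightarrow> pairing (\<lambda>i. z q (i + j)) R \<in> {0..<\<bar>coeff R 0\<bar>}"
    by metis
  define pattern where "pattern q = (\<lambda>j\<in>{..n}. pairing (\<lambda>i. z q (i + j)) R,
    \<lambda>i\<in>{n<..<n + m}. \<lfloor>real D * frac (\<theta> i * real q)\<rfloor>)" for q
  let ?T = "({..n} \<rightarrow>\<^sub>E {0..<\<bar>coeff R 0\<bar>}) \<times> ({n<..<n + m} \<rightarrow>\<^sub>E {0..<int D})"
  have "real D * frac a < real D * 1" for a
    using assms(3) frac_lt_1 by (intro mult_strict_left_mono) auto
  then have "\<lfloor>real D * frac (\<theta> i * real q)\<rfloor> \<in> {0..<int D}" for i q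
    by (simp add: floor_less_iff)
  then have "pattern q \<in> ?T" for q
    using residue by (auto simp: pattern_def intro!: restrict_PiE_iff[THEN iffD2])
  moreover have "finite ?T" by (intro finite_cartesian_product finite_PiE) auto
  ultimately obtain q q' where q: "q \<le> card ?T" "q' \<le> card ?T" "q \<noteq> q'"
    and same: "pattern q = pattern q'"
    using pigeonhole_atMost_card[of ?T pattern] by blast
  show ?thesis
  proof (rule that[of "\<lambda>i. z q i - z q' i"])
    have top_eq: "z q (n + m) - z q' (n + m) = int q - int q'"
      using top[of "n + m"] assms(2) by simp
    then show "z q (n + m) - z q' (n + m) \<noteq> 0" using q(3) by simp
    have "int (card ?T) = \<bar>coeff R 0\<bar> ^ (n + 1) * int D ^ (m - 1)"
      by (simp add: card_cartesian_product card_PiE)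
    then show "\<bar>z q (n + m) - z q' (n + m)\<bar> \<le> \<bar>coeff R 0\<bar> ^ (n + 1) * int D ^ (m - 1)"
      unfolding top_eq using q(1,2) by linarith
    have "pairing (\<lambda>i. z q (i + j)) R = pairing (\<lambda>i. z q' (i + j)) R" if "j \<le> n" for j
      using same that by (auto simp: pattern_def fun_eq_iff restrict_def split: if_splits)
    then show "annihilates n R (\<lambda>i. z q i - z q' i)"
      by (simp add: annihilates_def pairing_diff_left)
    fix i assume i: "n < i" "i < n + m"
    then have "\<lfloor>real D * frac (\<theta> i * real q)\<rfloor> = \<lfloor>real D * frac (\<theta> i * real q')\<rfloor>"
      using same by (auto simp: pattern_def fun_eq_iff restrict_def split: if_splits)
    then show "\<bar>real_of_int (z q i - z q' i) - \<theta> i * real_of_int (z q (n + m) - z q' (n + m))\<bar>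
        \<le> 1 / real D"
      unfolding top_eq
      using abs_floor_diff_le[of "real D" "\<theta> i * real q" "\<theta> i * real q'"] top[of i] i assms(3)
      by (simp add: right_diff_distrib)
  qed
qed

lemma exists_annihilated_near_geometric_top:
  fixes R :: "int poly" and \<eta> :: real and D :: nat
  assumes "coeff R 0 \<noteq> 0" "\<eta> \<noteq> 0" "1 \<le> m" "1 \<le> D"
  obtains t z where "1 / \<bar>\<eta>\<bar> ^ (n + m) \<le> \<bar>t\<bar>"
    "\<bar>t\<bar> \<le> 1 / \<bar>\<eta>\<bar> ^ (n + m) * (real_of_int \<bar>coeff R 0\<bar> ^ (n + 1) * real D ^ (m - 1))"
    "annihilates n R z" "\<And>i. n < i \<Longrightarrow> i \<le> n + m \<Longrightarrow> \<bar>real_of_int (z i) - t * \<eta> ^ i\<bar> \<le> 1 / real D"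
proof -
  obtain z where z: "z (n + m) \<noteq> 0" "\<bar>z (n + m)\<bar> \<le> \<bar>coeff R 0\<bar> ^ (n + 1) * int D ^ (m - 1)"
    "annihilates n R z"
    and approx: "\<And>i. n < i \<Longrightarrow> i < n + m \<Longrightarrow> \<bar>z i - \<eta> ^ i / \<eta> ^ (n + m) * z (n + m)\<bar> \<le> 1 / real D"
    using exists_annihilated_approximation[OF assms(1,3,4),
      where n = n and \<theta> = "\<lambda>i. \<eta> ^ i / \<eta> ^ (n + m)"]
    by blast
  define t where "t = z (n + m) / \<eta> ^ (n + m)"
  have t: "\<bar>t\<bar> = 1 / \<bar>\<eta>\<bar> ^ (n + m) * real_of_int \<bar>z (n + m)\<bar>"
    by (simp add: t_def abs_divide power_abs)
  have "1 \<le> real_of_int \<bar>z (n + m)\<bar>" using z(1) by linarith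
  then have "1 / \<bar>\<eta>\<bar> ^ (n + m) \<le> \<bar>t\<bar>" unfolding t by (simp add: divide_right_mono)
  moreover have "real_of_int \<bar>z (n + m)\<bar> \<le> real_of_int (\<bar>coeff R 0\<bar> ^ (n + 1) * int D ^ (m - 1))"
    using z(2) by (simp only: of_int_le_iff)
  then have "\<bar>t\<bar> \<le> 1 / \<bar>\<eta>\<bar> ^ (n + m) * (real_of_int \<bar>coeff R 0\<bar> ^ (n + 1) * real D ^ (m - 1))"
    unfolding t by (intro mult_left_mono) auto
  moreover have "\<bar>real_of_int (z i) - t * \<eta> ^ i\<bar> \<le> 1 / real D" if "n < i" "i \<le> n + m" for i
  proof (cases "i = n + m")
    case True
    then show ?thesis using assms(2) by (simp add: t_def)
  next
    case False
    then show ?thesis using approx[of i] that by (simp add: t_def mult.commute)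
  qed
  ultimately show ?thesis using that z(3) by blast
qed

lemma downward_recurrence_bound:
  fixes e :: "nat \<Rightarrow> real"
  assumes "1 \<le> m" "0 \<le> B" "0 \<le> W"
    and top: "\<And>i. n < i \<Longrightarrow> i \<le> n + m \<Longrightarrow> \<bar>e i\<bar> \<le> W"
    and rec: "\<And>j. j \<le> n \<Longrightarrow> \<bar>e j\<bar> \<le> B * (\<Sum>k=1..m. \<bar>e (j + k)\<bar>) + W"
  shows "n + m \<le> i + d \<Longrightarrow> i \<le> n + m \<Longrightarrow> \<bar>e i\<bar> \<le> (real m * B + 1) ^ d * W"
proof (induction d arbitrary: i)
  case 0
  then show ?case using top[of i] assms(1) by simp
next
  case (Suc d)
  let ?A = "real m * B + 1"
  have A: "1 \<le> ?A ^ k" for k using assms(2) by (intro one_le_power) simp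
  show ?case
  proof (cases "n < i")
    case True
    then show ?thesis
      using top[OF True Suc.prems(2)] mult_right_mono[OF A assms(3), of "Suc d"] by simp
  next
    case False
    have "(\<Sum>k=1..m. \<bar>e (i + k)\<bar>) \<le> real (card {1..m}) * (?A ^ d * W)"
      using False Suc.prems by (intro sum_bounded_above Suc.IH) auto
    then have "B * (\<Sum>k=1..m. \<bar>e (i + k)\<bar>) \<le> B * (real m * (?A ^ d * W))"
      using assms(2) by (intro mult_left_mono) auto
    moreover have "1 * W \<le> ?A ^ d * W" using A assms(3) by (rule mult_right_mono)
    ultimately have "\<bar>e i\<bar> \<le> B * (real m * (?A ^ d * W)) + ?A ^ d * W"
      using rec[of i] False by simp
    also have "\<dots> = ?A ^ Suc d * W" by (simp add: algebra_simps)
    finally show ?thesis .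
  qed
qed

lemma annihilated_sequence_near_geometric:
  fixes z :: "nat \<Rightarrow> int" and \<eta> t B W :: real
  assumes "degree R \<le> m" "1 \<le> m" "coeff R 0 \<noteq> 0" "annihilates n R z"
    and dominant: "\<And>k. real_of_int \<bar>coeff R k\<bar> \<le> B * real_of_int \<bar>coeff R 0\<bar>"
    and top: "\<And>i. n < i \<Longrightarrow> i \<le> n + m \<Longrightarrow> \<bar>z i - t * \<eta> ^ i\<bar> \<le> W"
    and defect: "\<And>j. j \<le> n \<Longrightarrow> \<bar>t * \<eta> ^ j * ipoly R \<eta>\<bar> \<le> W"
    and "i \<le> n + m"
  shows "\<bar>z i - t * \<eta> ^ i\<bar> \<le> (real m * B + 1) ^ (n + m) * W"
proof -
  define e where "e i = z i - t * \<eta> ^ i" for i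
  have "0 \<le> W" using defect[of 0] by linarith
  have c0: "1 \<le> real_of_int \<bar>coeff R 0\<bar>" using assms(3) by linarith
  have B: "0 \<le> B"
    using zero_less_mult_pos2[of B "real_of_int \<bar>coeff R 0\<bar>"] dominant[of 0] c0 by linarith
  have rec: "\<bar>e j\<bar> \<le> B * (\<Sum>k=1..m. \<bar>e (j + k)\<bar>) + W" if j: "j \<le> n" for j
  proof -
    let ?c = "\<lambda>k. real_of_int (coeff R k)"
    have "pairing (\<lambda>i. e (i + j)) (of_int_poly R)
        = real_of_int (pairing (\<lambda>i. z (i + j)) R) - t * \<eta> ^ j * ipoly R \<eta>"
      using pairing_scale_left[of "t * \<eta> ^ j" "\<lambda>i. \<eta> ^ i" "of_int_poly R"]
      by (simp add: e_def pairing_diff_left pairing_powers of_int_hom.pairing_map_poly power_add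
          mult_ac)
    also have "pairing (\<lambda>i. z (i + j)) R = 0" using assms(4) j by (rule annihilatesD)
    finally have "?c 0 * e j = - (\<Sum>k=1..m. ?c k * e (j + k)) - t * \<eta> ^ j * ipoly R \<eta>"
      using assms(1) by (subst (asm) pairing_eq_head_tail[of _ m]) (simp_all add: add.commute)
    then have "\<bar>?c 0 * e j\<bar> \<le> \<bar>\<Sum>k=1..m. ?c k * e (j + k)\<bar> + W"
      using defect[OF j] by linarith
    also have "\<bar>\<Sum>k=1..m. ?c k * e (j + k)\<bar> \<le> (\<Sum>k=1..m. B * \<bar>?c 0\<bar> * \<bar>e (j + k)\<bar>)"
      using dominant
      by (intro order_trans[OF sum_abs sum_mono]) (auto simp: abs_mult intro!: mult_right_mono)
    also have "\<dots> = \<bar>?c 0\<bar> * (B * (\<Sum>k=1..m. \<bar>e (j + k)\<bar>))" by (simp add: sum_distrib_left mult_ac)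
    also have "W \<le> \<bar>?c 0\<bar> * W" using mult_right_mono[OF c0 \<open>0 \<le> W\<close>] by simp
    finally have "\<bar>?c 0\<bar> * \<bar>e j\<bar> \<le> \<bar>?c 0\<bar> * (B * (\<Sum>k=1..m. \<bar>e (j + k)\<bar>) + W)"
      by (simp add: abs_mult distrib_left)
    then show ?thesis using c0 by (subst (asm) mult_le_cancel_left_pos) auto
  qed
  have "\<bar>e i\<bar> \<le> (real m * B + 1) ^ (n + m) * W"
    by (rule downward_recurrence_bound[OF assms(2) B \<open>0 \<le> W\<close> _ rec])
      (use top assms(8) in \<open>auto simp: e_def\<close>)
  then show ?thesis by (simp add: e_def)
qed

lemma approximates_powers_of_near_geometric:
  fixes z :: "nat \<Rightarrow> int" and t \<eta> W :: real
  assumes "\<And>i. i \<le> n \<Longrightarrow> \<bar>z i - t * \<eta> ^ i\<bar> \<le> W"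
  shows "approximates_powers \<eta> n z ((1 + max 1 \<bar>\<eta>\<bar> ^ n) * W)"
  unfolding approximates_powers_def
proof (intro allI impI)
  fix i assume i: "i \<le> n"
  have "\<eta> ^ i * z 0 - z i = \<eta> ^ i * (z 0 - t * \<eta> ^ 0) - (z i - t * \<eta> ^ i)"
    by (simp add: algebra_simps)
  moreover have "\<bar>\<eta> ^ i * (z 0 - t * \<eta> ^ 0)\<bar> \<le> max 1 \<bar>\<eta>\<bar> ^ n * W"
    unfolding abs_mult using assms[of 0] abs_power_le_max_power[OF i, of \<eta>]
    by (intro mult_mono) auto
  ultimately show "\<bar>\<eta> ^ i * z 0 - z i\<bar> \<le> (1 + max 1 \<bar>\<eta>\<bar> ^ n) * W"
    using assms[OF i] by (simp add: distrib_right)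
qed

definition constant_coeff_dominant :: "real \<Rightarrow> int poly \<Rightarrow> bool" where
  "constant_coeff_dominant B R \<longleftrightarrow> coeff R 0 \<noteq> 0 \<and> height R \<le> B * real_of_int \<bar>coeff R 0\<bar>"

lemma exists_near_geometric_sequence:
  fixes \<eta> B :: real and n m s :: nat
  defines "Z \<equiv> max 1 \<bar>\<eta>\<bar> ^ (n + m)" and "Y \<equiv> 1 / \<bar>\<eta>\<bar> ^ (n + m)"
  assumes "\<eta> \<noteq> 0" "1 \<le> m" "degree R \<le> m" and R: "constant_coeff_dominant B R"
    and small: "\<bar>ipoly R \<eta>\<bar> * real_of_int (height R) ^ (n + 1 + m * s) \<le> 1"
  obtains t z where "Y \<le> \<bar>t\<bar>" "\<bar>t\<bar> \<le> Y * real_of_int (height R) ^ (n + 1 + s * (m - 1))"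
    "\<And>i. i \<le> n + m \<Longrightarrow> \<bar>real_of_int (z i) - t * \<eta> ^ i\<bar>
      \<le> (real m * B + 1) ^ (n + m) * ((1 + Y * Z) / real_of_int (height R) ^ s)"
proof -
  define h where "h = real_of_int (height R)"
  define W where "W = (1 + Y * Z) / h ^ s"
  have R0: "coeff R 0 \<noteq> 0" using R by (simp add: constant_coeff_dominant_def)
  then have "R \<noteq> 0" by auto
  then have h: "1 \<le> h" unfolding h_def using height_ge_1 by simp
  have coeff_le: "real_of_int \<bar>coeff R k\<bar> \<le> h" for k
    unfolding h_def using abs_coeff_le_height[of R k] by linarith
  have YZ: "0 < Y" "1 \<le> Z" unfolding Y_def Z_def using assms(3) by (auto intro: one_le_power)
  define D where "D = nat (height R) ^ s"
  have D: "real D = h ^ s" "1 \<le> D" using h by (simp_all add: D_def h_def one_le_power)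
  obtain t z where t: "Y \<le> \<bar>t\<bar>" "\<bar>t\<bar> \<le> Y * (real_of_int \<bar>coeff R 0\<bar> ^ (n + 1) * real D ^ (m - 1))"
    and z: "annihilates n R z"
    and top: "\<And>i. n < i \<Longrightarrow> i \<le> n + m \<Longrightarrow> \<bar>real_of_int (z i) - t * \<eta> ^ i\<bar> \<le> 1 / real D"
    using exists_annihilated_near_geometric_top[OF R0 assms(3,4) D(2), where n = n]
    unfolding Y_def by metis
  have "real_of_int \<bar>coeff R 0\<bar> ^ (n + 1) * real D ^ (m - 1) \<le> h ^ (n + 1) * (h ^ s) ^ (m - 1)"
    unfolding D(1) using coeff_le h by (intro mult_right_mono power_mono) auto
  also have "\<dots> = h ^ (n + 1 + s * (m - 1))" by (simp add: power_add power_mult)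
  finally have t_le: "\<bar>t\<bar> \<le> Y * h ^ (n + 1 + s * (m - 1))"
    by (rule order_trans[OF t(2) mult_left_mono]) (use YZ(1) in simp)
  have "\<bar>t * \<eta> ^ j * ipoly R \<eta>\<bar> \<le> W" if "j \<le> n" for j
  proof -
    have "\<bar>t * \<eta> ^ j * ipoly R \<eta>\<bar> \<le> Y * h ^ (n + 1 + s * (m - 1)) * Z * \<bar>ipoly R \<eta>\<bar>"
      unfolding abs_mult using t_le abs_power_le_max_power[of j "n + m" \<eta>] that YZ h
      by (intro mult_mono) (auto simp: Z_def)
    also have "\<dots> = Y * Z * (\<bar>ipoly R \<eta>\<bar> * h ^ (n + 1 + s * (m - 1) + s)) / h ^ s"
      using h by (simp add: power_add)
    also have "n + 1 + s * (m - 1) + s = n + 1 + m * s" using assms(4) by (cases m) auto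
    also have "Y * Z * (\<bar>ipoly R \<eta>\<bar> * h ^ (n + 1 + m * s)) / h ^ s \<le> Y * Z * 1 / h ^ s"
      using small YZ h unfolding h_def by (intro divide_right_mono mult_left_mono) auto
    also have "\<dots> \<le> W" using h by (simp add: W_def divide_right_mono)
    finally show ?thesis .
  qed
  moreover have "1 / real D \<le> W" unfolding W_def D(1) using YZ h by (intro divide_right_mono) auto
  then have "\<bar>real_of_int (z i) - t * \<eta> ^ i\<bar> \<le> W" if "n < i" "i \<le> n + m" for i
    using top[OF that] by linarith
  moreover have "real_of_int \<bar>coeff R k\<bar> \<le> B * real_of_int \<bar>coeff R 0\<bar>" for k
    using coeff_le[of k] R by (simp add: h_def constant_coeff_dominant_def)
  ultimately have "\<bar>real_of_int (z i) - t * \<eta> ^ i\<bar> \<le> (real m * B + 1) ^ (n + m) * W"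
    if "i \<le> n + m" for i
    using annihilated_sequence_near_geometric[OF assms(5,4) R0 z, of B t \<eta> W] that by blast
  then show ?thesis using that t(1) t_le unfolding W_def h_def by blast
qed

lemma approximation_of_near_geometric:
  fixes y :: "nat \<Rightarrow> int" and h t \<eta> K Y :: real and \<kappa> n s :: nat
  defines "C \<equiv> (1 + max 1 \<bar>\<eta>\<bar> ^ n) * K + Y + K / Y"
  assumes "0 < Y" "0 \<le> K" "1 \<le> h" and t: "Y \<le> \<bar>t\<bar>" "\<bar>t\<bar> \<le> Y * h ^ \<kappa>"
    and near: "\<And>i. i \<le> n \<Longrightarrow> \<bar>y i - t * \<eta> ^ i\<bar> \<le> K / h ^ s"
  shows "real_of_int \<bar>y 0\<bar> \<le> C * h ^ \<kappa>" "approximates_powers \<eta> n y (C / h ^ s)"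
      "C < h ^ s \<Longrightarrow> y 0 \<noteq> 0"
proof -
  have h: "1 \<le> h ^ k" for k using assms(4) by (rule one_le_power)
  have hs: "0 < h ^ s" using h[of s] by linarith
  have K_Y: "0 \<le> K / Y" using assms(2,3) by simp
  have K_le: "K * 1 \<le> K * h ^ k" for k by (rule mult_left_mono[OF h assms(3)])
  have "1 * K \<le> (1 + max 1 \<bar>\<eta>\<bar> ^ n) * K" using assms(3) by (intro mult_right_mono) auto
  then have C: "(1 + max 1 \<bar>\<eta>\<bar> ^ n) * K \<le> C" "Y + K \<le> C" "K / Y \<le> C"
    using assms(2,3) K_Y unfolding C_def by linarith+
  have "K / h ^ s \<le> K" using K_le[of s] hs by (simp add: divide_le_eq)
  then have "real_of_int \<bar>y 0\<bar> \<le> Y * h ^ \<kappa> + K * h ^ \<kappa>" using near[of 0] t(2) K_le[of \<kappa>] by simp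
  also have "\<dots> \<le> C * h ^ \<kappa>"
    using C(2) h[of \<kappa>] by (subst distrib_right[symmetric]) (intro mult_right_mono, auto)
  finally show "real_of_int \<bar>y 0\<bar> \<le> C * h ^ \<kappa>" .
  have "approximates_powers \<eta> n y ((1 + max 1 \<bar>\<eta>\<bar> ^ n) * (K / h ^ s))"
    using near by (rule approximates_powers_of_near_geometric)
  then show "approximates_powers \<eta> n y (C / h ^ s)"
    using C(1) hs by (elim approximates_powers_mono) (simp_all add: divide_right_mono)
  show "y 0 \<noteq> 0" if "C < h ^ s"
  proof
    assume "y 0 = 0"
    then have "Y \<le> K / h ^ s" using near[of 0] t(1) by simp
    then have "h ^ s \<le> K / Y" using assms(2) hs by (simp add: field_simps)
    then show False using C(3) that by simp
  qed
qed

lemma exists_approximation_of_dominant_poly: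
  fixes \<eta> B :: real and n s :: nat
  assumes "\<eta> \<noteq> 0" "1 \<le> m"
  obtains C where "\<And>R. degree R \<le> m \<Longrightarrow> constant_coeff_dominant B R \<Longrightarrow>
    \<bar>ipoly R \<eta>\<bar> * real_of_int (height R) ^ (n + 1 + m * s) \<le> 1 \<Longrightarrow>
    \<exists>y. real_of_int \<bar>y 0\<bar> \<le> C * real_of_int (height R) ^ (n + 1 + s * (m - 1)) \<and>
      approximates_powers \<eta> (n + m) y (C / real_of_int (height R) ^ s) \<and>
      (C < real_of_int (height R) ^ s \<longrightarrow> y 0 \<noteq> 0)"
proof -
  define Y where "Y = 1 / \<bar>\<eta>\<bar> ^ (n + m)"
  define K where "K = \<bar>real m * B + 1\<bar> ^ (n + m) * (1 + Y * max 1 \<bar>\<eta>\<bar> ^ (n + m))"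
  have Y: "0 < Y" unfolding Y_def using assms(1) by simp
  then have K: "0 \<le> K" by (simp add: K_def)
  define C where "C = (1 + max 1 \<bar>\<eta>\<bar> ^ (n + m)) * K + Y + K / Y"
  show ?thesis
  proof (rule that[of C])
    fix R
    define h where "h = real_of_int (height R)"
    assume R: "degree R \<le> m" "constant_coeff_dominant B R"
      "\<bar>ipoly R \<eta>\<bar> * real_of_int (height R) ^ (n + 1 + m * s) \<le> 1"
    then have "R \<noteq> 0" by (auto simp: constant_coeff_dominant_def)
    then have h: "1 \<le> h" unfolding h_def using height_ge_1 by simp
    obtain t y where t: "Y \<le> \<bar>t\<bar>" "\<bar>t\<bar> \<le> Y * h ^ (n + 1 + s * (m - 1))"
      and near: "\<And>i. i \<le> n + m \<Longrightarrow> \<bar>real_of_int (y i) - t * \<eta> ^ i\<bar>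
        \<le> (real m * B + 1) ^ (n + m) * ((1 + Y * max 1 \<bar>\<eta>\<bar> ^ (n + m)) / h ^ s)"
      using exists_near_geometric_sequence[OF assms R] unfolding Y_def h_def by metis
    have "(real m * B + 1) ^ (n + m) * ((1 + Y * max 1 \<bar>\<eta>\<bar> ^ (n + m)) / h ^ s) \<le> K / h ^ s"
      unfolding K_def times_divide_eq_right using Y h
      by (intro divide_right_mono mult_right_mono) (auto simp flip: power_abs)
    then have "\<bar>real_of_int (y i) - t * \<eta> ^ i\<bar> \<le> K / h ^ s" if "i \<le> n + m" for i
      using near[OF that] by linarith
    note approximation_of_near_geometric[where n = "n + m", OF Y K h t this, folded C_def]
    then show "\<exists>y. real_of_int \<bar>y 0\<bar> \<le> C * real_of_int (height R) ^ (n + 1 + s * (m - 1)) \<and>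
      approximates_powers \<eta> (n + m) y (C / real_of_int (height R) ^ s) \<and>
      (C < real_of_int (height R) ^ s \<longrightarrow> y 0 \<noteq> 0)"
      unfolding h_def by blast
  qed
qed

text \<open>A polynomial of degree at most \<open>m\<close> cannot be small at all of the points \<open>0, \<dots>, m\<close>.\<close>

lemma exists_translate_infinite_dominant:
  assumes "ereal w < w_exp m \<zeta>"
  obtains b :: int and C :: real where "infinite {P. degree P \<le> m \<and> 0 < \<bar>ipoly P \<zeta>\<bar> \<and>
    \<bar>ipoly P \<zeta>\<bar> \<le> height P powr (- w) \<and> height P \<le> C * real_of_int \<bar>poly P b\<bar>}"
proof -
  obtain C where C: "\<And>P. degree P \<le> m \<Longrightarrow> \<exists>b\<in>{0..int m}. height P \<le> C * real_of_int \<bar>poly P b\<bar>"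
    using exists_value_comparable_to_height[of m] by blast
  let ?S = "{P. degree P \<le> m \<and> 0 < \<bar>ipoly P \<zeta>\<bar> \<and> \<bar>ipoly P \<zeta>\<bar> \<le> height P powr (- w)}"
  have "\<exists>b\<in>{0..int m}. infinite {P \<in> ?S. height P \<le> C * real_of_int \<bar>poly P b\<bar>}"
    by (rule pigeonhole_infinite_rel[OF less_w_expD[OF assms]]) (use C in auto)
  then show ?thesis using that by (auto simp: conj_assoc)
qed

lemma translate_dominant_small:
  fixes b :: int and C w \<zeta> :: real and m :: nat
  defines "c \<equiv> (2 + real_of_int \<bar>b\<bar>) ^ m"
  assumes P: "P \<noteq> 0" "degree P \<le> m" "\<bar>ipoly P \<zeta>\<bar> \<le> height P powr (- w)"
    and dominant: "height P \<le> C * real_of_int \<bar>poly P b\<bar>"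
    and large: "c ^ u * height P powr (real u - w) \<le> 1"
  shows "constant_coeff_dominant (c * C) (P \<circ>\<^sub>p [:b, 1:])" "height P \<le> C * height (P \<circ>\<^sub>p [:b, 1:])"
    "\<bar>ipoly (P \<circ>\<^sub>p [:b, 1:]) (\<zeta> - real_of_int b)\<bar> * real_of_int (height (P \<circ>\<^sub>p [:b, 1:])) ^ u \<le> 1"
proof -
  let ?R = "P \<circ>\<^sub>p [:b, 1:]"
  have h: "1 \<le> real_of_int (height P)" using height_ge_1[OF P(1)] by simp
  have R0: "coeff ?R 0 = poly P b" by (simp flip: poly_0_coeff_0 add: poly_pcompose)
  have nz: "coeff ?R 0 \<noteq> 0" using dominant h by (auto simp: R0)
  have "0 < C" using zero_less_mult_pos2[of C "real_of_int \<bar>poly P b\<bar>"] dominant h nz R0 by auto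
  have "real_of_int \<bar>poly P b\<bar> \<le> height ?R"
    unfolding of_int_le_iff using abs_coeff_le_height[of ?R 0] by (simp add: R0)
  then have "C * real_of_int \<bar>poly P b\<bar> \<le> C * height ?R"
    using \<open>0 < C\<close> by (intro mult_left_mono) auto
  then show "height P \<le> C * height ?R" using dominant by linarith
  have "real_of_int (height ?R) \<le> real_of_int ((2 + \<bar>b\<bar>) ^ degree P * height P)"
    unfolding of_int_le_iff by (rule height_translate_le)
  also have "\<dots> \<le> c * height P"
    using P(2) h unfolding c_def by (auto intro!: mult_right_mono power_increasing)
  finally have hR: "height ?R \<le> c * height P" .
  have c: "1 \<le> c" unfolding c_def by (intro one_le_power) simp
  have "c * height P \<le> c * (C * real_of_int \<bar>poly P b\<bar>)"
    using dominant c by (intro mult_left_mono) auto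
  then have "height ?R \<le> c * C * real_of_int \<bar>coeff ?R 0\<bar>" using hR by (simp only: R0 mult.assoc)
  then show "constant_coeff_dominant (c * C) ?R" using nz by (simp add: constant_coeff_dominant_def)
  have "ipoly ?R (\<zeta> - real_of_int b) = ipoly P \<zeta>"
    by (simp add: hom_distribs poly_pcompose)
  then have "\<bar>ipoly ?R (\<zeta> - real_of_int b)\<bar> * real_of_int (height ?R) ^ u
      \<le> height P powr (- w) * (c * height P) ^ u"
    using P(3) hR height_nonneg[of ?R] by (intro mult_mono power_mono) auto
  also have "\<dots> = c ^ u * (height P powr (- w) * height P powr real u)"
    using h by (simp add: power_mult_distrib powr_realpow)
  also have "\<dots> = c ^ u * height P powr (real u - w)" by (simp flip: powr_add)
  finally show "\<bar>ipoly ?R (\<zeta> - real_of_int b)\<bar> * real_of_int (height ?R) ^ u \<le> 1"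
    using large by linarith
qed

lemma exists_translate_dominant_small:
  assumes "ereal (real u) < w_exp m \<zeta>"
  obtains b :: int and B :: real where "\<And>h0 :: real.
    \<exists>R. degree R \<le> m \<and> h0 \<le> height R \<and> constant_coeff_dominant B R \<and>
      \<bar>ipoly R (\<zeta> - real_of_int b)\<bar> * real_of_int (height R) ^ u \<le> 1"
proof -
  obtain w where w: "real u < w" "ereal w < w_exp m \<zeta>"
    using assms ereal_dense2[of "ereal (real u)" "w_exp m \<zeta>"] by auto
  obtain b C where inf: "infinite {P. degree P \<le> m \<and> 0 < \<bar>ipoly P \<zeta>\<bar> \<and>
      \<bar>ipoly P \<zeta>\<bar> \<le> height P powr (- w) \<and> height P \<le> C * real_of_int \<bar>poly P b\<bar>}" (is "infinite ?S")
    by (rule exists_translate_infinite_dominant[OF w(2)])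
  define c where "c = (2 + real_of_int \<bar>b\<bar>) ^ m"
  have "\<exists>R. degree R \<le> m \<and> h0 \<le> height R \<and> constant_coeff_dominant (c * C) R \<and>
    \<bar>ipoly R (\<zeta> - real_of_int b)\<bar> * real_of_int (height R) ^ u \<le> 1" for h0 :: real
  proof -
    have "\<forall>\<^sub>F h in at_top. c ^ u * h powr (real u - w) < 1"
      using w(1) by (intro eventually_mult_powr_less) auto
    then obtain h1 where h1: "\<And>h. h1 \<le> h \<Longrightarrow> c ^ u * h powr (real u - w) < 1"
      unfolding eventually_at_top_linorder by blast
    have "\<not> ?S \<subseteq> {P. degree P \<le> m \<and> height P \<le> \<lceil>max h1 (C * h0)\<rceil>}"
      using inf finite_polys_height_le finite_subset by blast
    then obtain P where P: "P \<in> ?S" and "\<not> (degree P \<le> m \<and> height P \<le> \<lceil>max h1 (C * h0)\<rceil>)" by blast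
    then have "\<lceil>max h1 (C * h0)\<rceil> < height P" by auto
    then have "h1 \<le> height P" "C * h0 < height P" by linarith+
    have "P \<noteq> 0" using P by auto
    have "c ^ u * height P powr (real u - w) \<le> 1" using h1[OF \<open>h1 \<le> height P\<close>] by simp
    note R = translate_dominant_small[OF \<open>P \<noteq> 0\<close>, of m \<zeta> w C b u, folded c_def, OF _ _ _ this]
    have hP: "1 \<le> height P" "height P \<le> C * height (P \<circ>\<^sub>p [:b, 1:])"
      using P R(2) height_ge_1[OF \<open>P \<noteq> 0\<close>] by auto
    then have "0 < C * height (P \<circ>\<^sub>p [:b, 1:])" by linarith
    then have "0 < C" using height_nonneg[of "P \<circ>\<^sub>p [:b, 1:]"] by (simp add: zero_less_mult_iff)
    moreover have "C * h0 < C * height (P \<circ>\<^sub>p [:b, 1:])" using hP(2) \<open>C * h0 < height P\<close> by linarith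
    ultimately have "h0 \<le> height (P \<circ>\<^sub>p [:b, 1:])" by simp
    moreover have "degree (P \<circ>\<^sub>p [:b, 1:]) \<le> m" using P by (simp add: degree_pcompose)
    ultimately show ?thesis using P R(1,3) by blast
  qed
  then show ?thesis using that by blast
qed

lemma le_lambda_exp_of_less_w_exp:
  assumes "\<zeta> \<notin> \<int>" "1 \<le> m" "1 \<le> s" "ereal (real (n + 1 + m * s)) < w_exp m \<zeta>"
  shows "ereal (real s / real (n + 1 + s * (m - 1))) \<le> lambda_exp (n + m) \<zeta>"
proof -
  obtain b B where dominant: "\<And>h0 :: real.
      \<exists>R. degree R \<le> m \<and> h0 \<le> height R \<and> constant_coeff_dominant B R \<and>
        \<bar>ipoly R (\<zeta> - real_of_int b)\<bar> * real_of_int (height R) ^ (n + 1 + m * s) \<le> 1"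
    using exists_translate_dominant_small[OF assms(4)] by blast
  define \<eta> where "\<eta> = \<zeta> - real_of_int b"
  have "\<eta> \<noteq> 0" using assms(1) by (auto simp: \<eta>_def)
  then obtain C where C: "\<And>R. degree R \<le> m \<Longrightarrow> constant_coeff_dominant B R \<Longrightarrow>
    \<bar>ipoly R \<eta>\<bar> * real_of_int (height R) ^ (n + 1 + m * s) \<le> 1 \<Longrightarrow>
    \<exists>y. real_of_int \<bar>y 0\<bar> \<le> C * real_of_int (height R) ^ (n + 1 + s * (m - 1)) \<and>
      approximates_powers \<eta> (n + m) y (C / real_of_int (height R) ^ s) \<and>
      (C < real_of_int (height R) ^ s \<longrightarrow> y 0 \<noteq> 0)"
    using exists_approximation_of_dominant_poly[OF _ assms(2)] by blast
  have "ereal (real s / real (n + 1 + s * (m - 1))) \<le> lambda_exp (n + m) \<eta>"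
  proof (rule le_lambda_expI)
    show "1 \<le> n + m" using assms(2) by simp
    show "0 < real (n + 1 + s * (m - 1))" unfolding of_nat_0_less_iff by simp
    fix h0
    obtain R where R: "degree R \<le> m" "max 1 (max h0 (C + 1)) \<le> height R"
      "constant_coeff_dominant B R"
      "\<bar>ipoly R \<eta>\<bar> * real_of_int (height R) ^ (n + 1 + m * s) \<le> 1"
      using dominant unfolding \<eta>_def by blast
    define h where "h = real_of_int (height R)"
    have h: "1 \<le> h" "h0 \<le> h" "C < h" using R(2) by (auto simp: h_def)
    obtain y where y: "real_of_int \<bar>y 0\<bar> \<le> C * h ^ (n + 1 + s * (m - 1))"
      "approximates_powers \<eta> (n + m) y (C / h ^ s)" "C < h ^ s \<longrightarrow> y 0 \<noteq> 0"
      using C[OF R(1,3,4)] unfolding h_def by blast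
    have "h ^ 1 \<le> h ^ s" using h(1) assms(3) by (intro power_increasing) auto
    then have "y 0 \<noteq> 0" using y(3) h(3) by simp
    moreover have powr_eq: "h powr real k = h ^ k" for k using h(1) by (simp add: powr_realpow)
    moreover have "C * h powr (- real s) = C / h ^ s" by (simp add: powr_minus_divide powr_eq)
    ultimately show "\<exists>h\<ge>h0. \<exists>y. y 0 \<noteq> 0 \<and>
        real_of_int \<bar>y 0\<bar> \<le> C * h powr real (n + 1 + s * (m - 1)) \<and>
        approximates_powers \<eta> (n + m) y (C * h powr (- real s))"
      using y(1,2) h(2) by metis
  qed
  also have "lambda_exp (n + m) \<eta> = lambda_exp (n + m) \<zeta>"
    using lambda_exp_translate[of "n + m" \<eta> b] assms(2) by (simp add: \<eta>_def)
  finally show ?thesis .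
qed

section \<open>Mahler's classes\<close>

lemma limsup_less_infinity_iff:
  fixes f :: "nat \<Rightarrow> ereal"
  shows "limsup f < \<infinity> \<longleftrightarrow> (\<exists>K :: nat. \<forall>\<^sub>F n in sequentially. f n \<le> ereal (real K))"
proof
  assume "limsup f < \<infinity>"
  then obtain C where "limsup f < ereal C" using ereal_dense2 by blast
  then have "\<forall>\<^sub>F n in sequentially. f n < ereal C" by (rule Limsup_lessD)
  moreover obtain K :: nat where "C \<le> real K" using real_arch_simple by blast
  ultimately have "\<forall>\<^sub>F n in sequentially. f n \<le> ereal (real K)"
    by (auto elim!: eventually_mono intro: order_trans less_imp_le)
  then show "\<exists>K :: nat. \<forall>\<^sub>F n in sequentially. f n \<le> ereal (real K)" by blast
next
  assume "\<exists>K :: nat. \<forall>\<^sub>F n in sequentially. f n \<le> ereal (real K)"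
  then obtain K :: nat where "limsup f \<le> ereal (real K)" using Limsup_bounded by blast
  then show "limsup f < \<infinity>" by (rule le_less_trans) simp
qed

lemma S_number_iff:
  "S_number \<zeta> \<longleftrightarrow> (\<exists>K :: nat. \<forall>\<^sub>F n in sequentially. w_exp n \<zeta> \<le> ereal (real K * real n))"
proof -
  have "(\<forall>\<^sub>F n in sequentially. w_exp n \<zeta> / ereal (real n) \<le> ereal (real K))
      \<longleftrightarrow> (\<forall>\<^sub>F n in sequentially. w_exp n \<zeta> \<le> ereal (real K * real n))" for K :: nat
    by (rule eventually_cong[OF eventually_gt_at_top[of 0]])
      (simp add: ereal_divide_le_pos mult.commute)
  then show ?thesis unfolding S_number_def limsup_less_infinity_iff by simp
qed

lemma limsup_lambda_exp_less_infinity_iff: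
  "limsup (\<lambda>n. ereal (real n) * lambda_exp n \<zeta>) < \<infinity>
    \<longleftrightarrow> (\<exists>K :: nat. \<forall>\<^sub>F n in sequentially. lambda_exp n \<zeta> \<le> ereal (real K / real n))"
proof -
  have "(\<forall>\<^sub>F n in sequentially. ereal (real n) * lambda_exp n \<zeta> \<le> ereal (real K))
      \<longleftrightarrow> (\<forall>\<^sub>F n in sequentially. lambda_exp n \<zeta> \<le> ereal (real K / real n))" for K :: nat
  proof (rule eventually_cong[OF eventually_gt_at_top[of 0]])
    fix n :: nat assume "0 < n"
    then have quotient: "ereal (real K / real n) = ereal (real K) / ereal (real n)" by simp
    show "ereal (real n) * lambda_exp n \<zeta> \<le> ereal (real K)
        \<longleftrightarrow> lambda_exp n \<zeta> \<le> ereal (real K / real n)"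
      unfolding quotient using \<open>0 < n\<close> by (subst ereal_le_divide_pos) auto
  qed
  then show ?thesis unfolding limsup_less_infinity_iff by simp
qed

lemma eventually_lambda_exp_le_of_w_exp_le:
  assumes "\<not> algebraic \<zeta>" and w: "\<forall>\<^sub>F m in sequentially. w_exp m \<zeta> \<le> ereal (real K * real m)"
  shows "\<forall>\<^sub>F N in sequentially. lambda_exp N \<zeta> \<le> ereal (real (2 * (K + 3)) / real N)"
proof -
  obtain m0 where m0: "\<And>m. m0 \<le> m \<Longrightarrow> w_exp m \<zeta> \<le> ereal (real K * real m)"
    using w unfolding eventually_sequentially by blast
  have "lambda_exp N \<zeta> \<le> ereal (real (2 * (K + 3)) / real N)" if N: "(K + 3) * Suc m0 \<le> N" for N
  proof -
    define m where "m = N div (K + 3)"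
    define n where "n = N - m"
    have m: "Suc m0 \<le> m" using N by (simp add: m_def less_eq_div_iff_mult_less_eq mult.commute)
    have N_ge: "(K + 3) * m \<le> N" by (simp add: m_def)
    have "N < (K + 3) * (m + 1)"
      using dividend_less_times_div[of "K + 3" N] by (simp add: m_def)
    also have "\<dots> \<le> (K + 3) * (2 * m)" using m by (intro mult_left_mono) auto
    finally have N_le: "N \<le> 2 * (K + 3) * m" by (simp add: algebra_simps)
    have N_eq: "N = m + n" and n: "m \<le> n" "K * m + 1 < n"
      using N_ge m by (auto simp: n_def algebra_simps)
    have "real (K * m + 1) < real n" using n(2) by (rule of_nat_less_iff[THEN iffD2])
    then have "ereal (real K * real m) < ereal (real n - 1)" by simp
    moreover have "w_exp m \<zeta> \<le> ereal (real K * real m)" using m0 m by simp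
    ultimately have "w_exp m \<zeta> < ereal (real n - 1)" by (rule le_less_trans[rotated])
    then have "lambda_exp N \<zeta> \<le> ereal (1 / real m)"
      unfolding N_eq using le_w_exp_of_less_lambda_exp[OF assms(1), of m n] m n(1)
      by (force simp: not_le)
    also have "1 / real m \<le> real (2 * (K + 3)) / real N"
    proof -
      have "real N \<le> real (2 * (K + 3) * m)" using N_le by (rule of_nat_mono)
      then show ?thesis using m N_eq by (simp add: field_simps)
    qed
    finally show ?thesis by simp
  qed
  then show ?thesis unfolding eventually_sequentially by blast
qed

lemma eventually_w_exp_le_of_lambda_exp_le:
  assumes "\<zeta> \<notin> \<int>" and lambda: "\<forall>\<^sub>F N in sequentially. lambda_exp N \<zeta> \<le> ereal (real K / real N)"
  shows "\<forall>\<^sub>F m in sequentially. w_exp m \<zeta> \<le> ereal (real (2 * (2 * K + 1)) * real m)"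
proof -
  obtain N0 where N0: "\<And>N. N0 \<le> N \<Longrightarrow> lambda_exp N \<zeta> \<le> ereal (real K / real N)"
    using lambda unfolding eventually_sequentially by blast
  define s where "s = 2 * K + 1"
  then have s: "0 < s" by simp
  have "w_exp m \<zeta> \<le> ereal (real (2 * s) * real m)" if m: "N0 + 1 \<le> m" for m
  proof (rule ccontr)
    assume large: "\<not> w_exp m \<zeta> \<le> ereal (real (2 * s) * real m)"
    define n where "n = 2 * K * m"
    have N: "n + m = s * m" by (simp add: n_def s_def algebra_simps)
    have "n + 1 + m * s \<le> 2 * s * m" using m by (simp add: n_def s_def algebra_simps)
    then have "real (n + 1 + m * s) \<le> real (2 * s * m)" by (rule of_nat_mono)
    then have "ereal (real (n + 1 + m * s)) \<le> ereal (real (2 * s) * real m)" by simp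
    also have "\<dots> < w_exp m \<zeta>" using large by simp
    finally have "ereal (real s / real (n + 1 + s * (m - 1))) \<le> lambda_exp (n + m) \<zeta>"
      using m by (intro le_lambda_exp_of_less_w_exp assms(1)) (auto simp: s_def)
    also have "\<dots> \<le> ereal (real K / real (s * m))"
      unfolding N using m by (intro N0) (simp add: s_def)
    finally have "real s / real (n + 1 + s * (m - 1)) \<le> real K / real (s * m)" by simp
    moreover define d where "d = n + 1 + s * (m - 1)"
    have "1 \<le> d" "d \<le> 2 * (s * m)"
      using m N by (cases m; simp add: d_def algebra_simps)+
    then have "real s / real (2 * (s * m)) \<le> real s / real d"
      using m s by (intro divide_left_mono of_nat_mono mult_pos_pos) (auto simp: zero_less_mult_iff)
    ultimately have "real s / real (2 * (s * m)) \<le> real K / real (s * m)"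
      unfolding d_def by linarith
    then have "real s / 2 / real (s * m) \<le> real K / real (s * m)" by simp
    then have "real s / 2 \<le> real K" using m s by (subst (asm) divide_le_cancel) auto
    then show False by (simp add: s_def)
  qed
  then show ?thesis unfolding eventually_sequentially s_def by blast
qed

lemma not_Ints_of_not_algebraic: "\<not> algebraic x \<Longrightarrow> x \<notin> \<int>" for x :: real
  using rat_imp_algebraic Ints_subset_Rats by blast

lemma S_number_iff_limsup_lambda_exp:
  assumes "\<not> algebraic \<zeta>"
  shows "S_number \<zeta> \<longleftrightarrow> limsup (\<lambda>n. ereal (real n) * lambda_exp n \<zeta>) < \<infinity>"
  unfolding S_number_iff limsup_lambda_exp_less_infinity_iff
  using eventually_lambda_exp_le_of_w_exp_le[OF assms]
    eventually_w_exp_le_of_lambda_exp_le[OF not_Ints_of_not_algebraic[OF assms]] by meson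

lemma U_number_iff: "U_number \<zeta> \<longleftrightarrow> (\<exists>m\<ge>1. w_exp m \<zeta> = \<infinity>)"
proof
  assume "\<exists>m\<ge>1. w_exp m \<zeta> = \<infinity>"
  then have ex: "\<exists>m. 1 \<le> m \<and> w_exp m \<zeta> = \<infinity>" by blast
  define m where "m = (LEAST m. 1 \<le> m \<and> w_exp m \<zeta> = \<infinity>)"
  have "1 \<le> m \<and> w_exp m \<zeta> = \<infinity>" unfolding m_def by (rule LeastI_ex[OF ex])
  moreover have "\<not> (1 \<le> k \<and> w_exp k \<zeta> = \<infinity>)" if "k < m" for k
    using that unfolding m_def by (rule not_less_Least)
  ultimately show "U_number \<zeta>" unfolding U_number_def U_index_def by blast
qed (auto simp: U_number_def U_index_def)

lemma w_exp_infinite_of_frequently_less_lambda_exp: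
  assumes "\<not> algebraic \<zeta>" "1 \<le> m" "\<exists>\<^sub>F n in sequentially. ereal (1 / real m) < lambda_exp n \<zeta>"
  shows "w_exp m \<zeta> = \<infinity>"
proof -
  have "ereal (real k) \<le> w_exp m \<zeta>" for k
  proof -
    obtain N where "m + (k + m + 1) \<le> N" "ereal (1 / real m) < lambda_exp N \<zeta>"
      using assms(3) unfolding frequently_sequentially by blast
    then obtain n where n: "k + m + 1 \<le> n" "ereal (1 / real m) < lambda_exp (m + n) \<zeta>"
      by (metis add_leD1 le_add_diff_inverse nat_add_left_cancel_le)
    have "ereal (real k) \<le> ereal (real n - 1)" using n(1) by simp
    also have "\<dots> \<le> w_exp m \<zeta>" using assms n by (intro le_w_exp_of_less_lambda_exp) auto
    finally show ?thesis .
  qed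
  then show ?thesis by (intro ereal_top) (meson order_trans ereal_less_eq(3) real_arch_simple)
qed

lemma tendsto_linear_fractional:
  fixes a b :: real
  assumes "b \<noteq> 0"
  shows "(\<lambda>s. real s / (a + real s * b)) \<longlonglongrightarrow> 1 / b"
proof -
  have "(\<lambda>s. 1 / (a / real s + b)) \<longlonglongrightarrow> 1 / (0 + b)"
    using assms by (intro tendsto_intros lim_const_over_n) auto
  moreover have "\<forall>\<^sub>F s in sequentially. 1 / (a / real s + b) = real s / (a + real s * b)"
    using eventually_gt_at_top[of 0]
  proof eventually_elim
    case (elim s)
    then have "a + real s * b = real s * (a / real s + b)" by (simp add: distrib_left)
    then show ?case using elim by simp
  qed
  ultimately show ?thesis by (simp add: tendsto_cong)
qed

lemma lambda_exp_ge_of_w_exp_infinite: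
  assumes "\<zeta> \<notin> \<int>" "1 \<le> m" "w_exp m \<zeta> = \<infinity>"
  shows "1 / ereal (real m - 1) \<le> lambda_exp (n + m) \<zeta>"
proof -
  have bound: "ereal (real s / (real (n + 1) + real s * (real m - 1))) \<le> lambda_exp (n + m) \<zeta>"
    if "1 \<le> s" for s
    using le_lambda_exp_of_less_w_exp[OF assms(1,2) that, of n] assms(2,3)
    by (simp add: of_nat_diff add.assoc)
  show ?thesis
  proof (cases "m = 1")
    case True
    have "ereal r \<le> lambda_exp (n + m) \<zeta>" for r
    proof -
      obtain s where s: "max 1 (r * real (n + 1)) \<le> real s" using real_arch_simple by blast
      then have "ereal r \<le> ereal (real s / real (n + 1))" by (simp add: field_simps)
      also have "\<dots> \<le> lambda_exp (n + m) \<zeta>" using bound[of s] s True by simp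
      finally show ?thesis .
    qed
    then have "lambda_exp (n + m) \<zeta> = \<infinity>" by (rule ereal_top)
    then show ?thesis by simp
  next
    case False
    then have m: "real m - 1 > 0" using assms(2) by simp
    then have "(\<lambda>s. ereal (real s / (real (n + 1) + real s * (real m - 1))))
        \<longlonglongrightarrow> ereal (1 / (real m - 1))"
      by (intro tendsto_ereal tendsto_linear_fractional) simp
    then have "ereal (1 / (real m - 1)) \<le> lambda_exp (n + m) \<zeta>"
      using bound by (intro LIMSEQ_le_const2) blast+
    then show ?thesis using m by (simp add: one_ereal_def)
  qed
qed

lemma U_index_imp_eventually_lambda_exp:
  assumes "\<not> algebraic \<zeta>" "U_index m \<zeta>"
  shows "\<forall>\<^sub>F n in sequentially. lambda_exp n \<zeta> = 1 / ereal (real m - 1)"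
proof -
  have m: "1 \<le> m" "w_exp m \<zeta> = \<infinity>" using assms(2) by (auto simp: U_index_def)
  have "\<forall>\<^sub>F n in sequentially. 1 / ereal (real m - 1) \<le> lambda_exp n \<zeta>"
    using eventually_ge_at_top[of m]
  proof eventually_elim
    case (elim n)
    then show ?case
      using lambda_exp_ge_of_w_exp_infinite[OF not_Ints_of_not_algebraic[OF assms(1)] m, of "n - m"]
      by simp
  qed
  moreover have "\<forall>\<^sub>F n in sequentially. lambda_exp n \<zeta> \<le> 1 / ereal (real m - 1)"
  proof (cases "m = 1")
    case False
    then have m1: "1 \<le> m - 1" using m by simp
    then have "w_exp (m - 1) \<zeta> \<noteq> \<infinity>" using assms(2) by (auto simp: U_index_def)
    then have "\<not> (\<exists>\<^sub>F n in sequentially. ereal (1 / real (m - 1)) < lambda_exp n \<zeta>)"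
      using w_exp_infinite_of_frequently_less_lambda_exp[OF assms(1) m1] by blast
    moreover have "ereal (1 / real (m - 1)) = 1 / ereal (real m - 1)"
      using False m by (simp add: one_ereal_def of_nat_diff)
    ultimately show ?thesis by (simp add: not_frequently not_less)
  qed (simp add: divide_ereal_def flip: zero_ereal_def)
  ultimately show ?thesis by eventually_elim (rule antisym)
qed

lemma U_number_iff_lim_lambda_exp_pos:
  assumes "\<not> algebraic \<zeta>"
  shows "U_number \<zeta> \<longleftrightarrow> lim (\<lambda>n. lambda_exp n \<zeta>) > 0"
proof
  assume "U_number \<zeta>"
  then obtain m where m: "1 \<le> m" "U_index m \<zeta>" by (auto simp: U_number_def)
  have "(\<lambda>n. lambda_exp n \<zeta>) \<longlonglongrightarrow> 1 / ereal (real m - 1)"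
    using U_index_imp_eventually_lambda_exp[OF assms m(2)] by (rule tendsto_eventually)
  then have "lim (\<lambda>n. lambda_exp n \<zeta>) = 1 / ereal (real m - 1)" by (rule limI)
  moreover have "1 / ereal (real m - 1) > 0"
    using m(1) by (cases "m = 1") (auto simp: one_ereal_def zero_ereal_def)
  ultimately show "lim (\<lambda>n. lambda_exp n \<zeta>) > 0" by simp
next
  assume "lim (\<lambda>n. lambda_exp n \<zeta>) > 0"
  then obtain a where a: "0 < ereal a" "ereal a < lim (\<lambda>n. lambda_exp n \<zeta>)"
    using ereal_dense2 by blast
  then obtain k where k: "1 / real (Suc k) < a"
    using nat_approx_posE[of a] by (auto simp: zero_ereal_def)
  have "\<forall>\<^sub>F n in sequentially. ereal a < lambda_exp n \<zeta>"
    using order_tendstoD(1)[OF lambda_exp_tendsto_lim a(2)] .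
  then have "\<forall>\<^sub>F n in sequentially. ereal (1 / real (Suc k)) < lambda_exp n \<zeta>"
    using k by (auto elim!: eventually_mono intro: less_trans[of _ "ereal a"])
  then have "w_exp (Suc k) \<zeta> = \<infinity>"
    by (intro w_exp_infinite_of_frequently_less_lambda_exp[OF assms])
      (auto simp: eventually_frequently)
  then show "U_number \<zeta>" unfolding U_number_iff by (intro exI[of _ "Suc k"]) auto
qed

theorem theorem2p1:
  fixes \<zeta> :: real
  assumes "\<not> algebraic \<zeta>"
  shows "(U_number \<zeta> \<longleftrightarrow> lim (\<lambda>n. lambda_exp n \<zeta>) > 0)
    \<and> (\<forall>m. U_index m \<zeta> \<longrightarrow>
          (\<forall>\<^sub>F n in sequentially. lambda_exp n \<zeta> = 1 / ereal (real m - 1)))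
    \<and> (T_number \<zeta> \<longleftrightarrow>
          lim (\<lambda>n. lambda_exp n \<zeta>) = 0 \<and>
          limsup (\<lambda>n. ereal (real n) * lambda_exp n \<zeta>) = \<infinity>)
    \<and> (S_number \<zeta> \<longleftrightarrow> limsup (\<lambda>n. ereal (real n) * lambda_exp n \<zeta>) < \<infinity>)"
proof -
  note U = U_number_iff_lim_lambda_exp_pos[OF assms]
  note S = S_number_iff_limsup_lambda_exp[OF assms]
  have "T_number \<zeta> \<longleftrightarrow> \<not> U_number \<zeta> \<and> \<not> S_number \<zeta>"
    unfolding T_number_def S_number_def U_number_iff by auto
  then have "T_number \<zeta> \<longleftrightarrow> lim (\<lambda>n. lambda_exp n \<zeta>) = 0 \<and>
      limsup (\<lambda>n. ereal (real n) * lambda_exp n \<zeta>) = \<infinity>"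
    unfolding U S using lambda_exp_lim_nonneg[of \<zeta>] by auto
  then show ?thesis using U S U_index_imp_eventually_lambda_exp[OF assms] by blast
qed

end
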